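(* For $i=1,2,3$ let $G_i$ be a connected $r_i$-regular graph with $p_i$ vertices and $q_i$ edges and adjacency eigenvalues $r_i=\lambda_{i1}\geq\lambda_{i2}\geq\cdots\geq\lambda_{ip_i}$, where $G_1$ is triangle-free. Then the eigenvalues of $\epsilon(C[G_1]\vee(G_2^V\cup G_3^E))$, counted with multiplicity, are: (1) $(-1+\lambda_{1j})\pm\sqrt{(1+\lambda_{1j})^2+4(\lambda_{1j}+r_1)}$ for $j=2,3,\ldots,p_1$; (2) $-2$ with multiplicity $q_1-p_1$; (3) $0$ with multiplicity $p_2+p_3-2$; (4) the eigenvalues of the matrix $\begin{pmatrix}2r_1&2(q_1-r_1)&0&2p_3\\2(p_1-2)&2(q_1-1)&2p_2&0\\0&2q_1&0&3p_3\\2p_1&0&3p_2&0\end{pmatrix}$.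
   Context: All graphs are finite, simple, undirected and connected. For a connected graph $H$ with vertices $v_1,\ldots,v_n$, $d(v_i,v_j)$ is the distance and $e(v_i)=\max_j d(v_i,v_j)$ the eccentricity. The eccentricity matrix $\epsilon(H)$ has $(i,j)$ entry $d(v_i,v_j)$ if $d(v_i,v_j)=\min\{e(v_i),e(v_j)\}$ and $0$ otherwise. The central graph $C[G]$ has vertex set $V(G)\cup I(G)$, where $I(G)=\{w_e:e\in E(G)\}$; its edges are $uw_e$ for each edge $e$ and each endpoint $u$ of $e$, and $uv$ for all distinct $u,v\in V(G)$ nonadjacent in $G$ (original edges of $G$ are not kept). The central vertex-edge join $C[G_1]\vee(G_2^V\cup G_3^E)$ is obtained from the disjoint union of $C[G_1]$, $G_2$ and $G_3$ by joining every vertex of $V(G_1)$ to every vertex of $G_2$ and every vertex of $I(G_1)$ to every vertex of $G_3$. *)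

theory Defs
  imports
    "Graph_Theory.Graph_Theory"
    "Jordan_Normal_Form.Char_Poly"
    "HOL-Library.Multiset"
begin

text \<open>
  A finite simple undirected graph is a \<open>pair_graph\<close>: finite, loop-free, and with a symmetric
  set of arcs, so that every undirected edge is present as two opposite arcs.
\<close>

definition edges :: "'a pair_pre_digraph \<Rightarrow> 'a set set" where
  "edges G = {{u, v} | u v. (u, v) \<in> parcs G}"

definition regular :: "'a pair_pre_digraph \<Rightarrow> nat \<Rightarrow> bool" where
  "regular G r \<longleftrightarrow> (\<forall>v \<in> pverts G. out_degree (with_proj G) v = r)"

definition triangle_free :: "'a pair_pre_digraph \<Rightarrow> bool" where
  "triangle_free G \<longleftrightarrow>
     \<not> (\<exists>u v w. (u, v) \<in> parcs G \<and> (v, w) \<in> parcs G \<and> (u, w) \<in> parcs G)"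

text \<open>The library's shortest-path distance, with every arc of cost one.\<close>

definition graph_dist :: "'a pair_pre_digraph \<Rightarrow> 'a \<Rightarrow> 'a \<Rightarrow> ereal" where
  "graph_dist G u v = wf_digraph.\<mu> (with_proj G) (\<lambda>_. 1) u v"

definition eccentricity :: "'a pair_pre_digraph \<Rightarrow> 'a \<Rightarrow> ereal" where
  "eccentricity G u = Max (graph_dist G u ` pverts G)"

text \<open>
  Matrices of a graph refer to an enumeration \<open>vs = [v\<^sub>1, \<dots>, v\<^sub>n]\<close> of its vertices.
\<close>

definition enumerates :: "'a list \<Rightarrow> 'a pair_pre_digraph \<Rightarrow> bool" where
  "enumerates vs G \<longleftrightarrow> distinct vs \<and> set vs = pverts G"

definition adjacency_matrix :: "'a pair_pre_digraph \<Rightarrow> 'a list \<Rightarrow> real mat" where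
  "adjacency_matrix G vs =
     mat (length vs) (length vs) (\<lambda>(i, j). if (vs ! i, vs ! j) \<in> parcs G then 1 else 0)"

definition eccentricity_matrix :: "'a pair_pre_digraph \<Rightarrow> 'a list \<Rightarrow> real mat" where
  "eccentricity_matrix G vs =
     mat (length vs) (length vs) (\<lambda>(i, j).
       if graph_dist G (vs ! i) (vs ! j) = min (eccentricity G (vs ! i)) (eccentricity G (vs ! j))
       then real_of_ereal (graph_dist G (vs ! i) (vs ! j)) else 0)"

text \<open>
  The complex eigenvalues of a real matrix, counted with algebraic multiplicity.
\<close>

definition eigenvalues :: "real mat \<Rightarrow> complex multiset" where
  "eigenvalues A = proots (char_poly (map_mat complex_of_real A))"

text \<open>
  \<open>lam 1 \<ge> \<dots> \<ge> lam n\<close> are the adjacency eigenvalues of a graph with \<open>n\<close> vertices; they do not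
  depend on the enumeration.
\<close>

definition adjacency_eigenvalues :: "'a pair_pre_digraph \<Rightarrow> (nat \<Rightarrow> real) \<Rightarrow> bool" where
  "adjacency_eigenvalues G lam \<longleftrightarrow>
     antimono_on {1..card (pverts G)} lam \<and>
     (\<forall>vs. enumerates vs G \<longrightarrow>
        eigenvalues (adjacency_matrix G vs) =
          {# complex_of_real (lam j). j \<in># mset_set {1..card (pverts G)} #})"

text \<open>\<open>Inl u\<close> is the original vertex \<open>u\<close>, and \<open>Inr e\<close> is the new vertex \<open>w\<^sub>e\<close> of the edge \<open>e\<close>.\<close>

definition central_graph :: "'a pair_pre_digraph \<Rightarrow> ('a + 'a set) pair_pre_digraph" where
  "central_graph G =
     \<lparr> pverts = pverts G <+> edges G,
       parcs = {(Inl u, Inr e) | u e. e \<in> edges G \<and> u \<in> e}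
             \<union> {(Inr e, Inl u) | u e. e \<in> edges G \<and> u \<in> e}
             \<union> {(Inl u, Inl v) | u v. u \<in> pverts G \<and> v \<in> pverts G \<and> u \<noteq> v \<and> (u, v) \<notin> parcs G} \<rparr>"

definition central_vertex_edge_join ::
  "'a pair_pre_digraph \<Rightarrow> 'b pair_pre_digraph \<Rightarrow> 'c pair_pre_digraph \<Rightarrow>
     (('a + 'a set) + ('b + 'c)) pair_pre_digraph" where
  "central_vertex_edge_join G1 G2 G3 =
     (let J = {(Inl (Inl u), Inr (Inl x)) | u x. u \<in> pverts G1 \<and> x \<in> pverts G2}
            \<union> {(Inl (Inr e), Inr (Inr y)) | e y. e \<in> edges G1 \<and> y \<in> pverts G3}
      in \<lparr> pverts = pverts (central_graph G1) <+> (pverts G2 <+> pverts G3),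
           parcs = {(Inl a, Inl b) | a b. (a, b) \<in> parcs (central_graph G1)}
                 \<union> {(Inr (Inl x), Inr (Inl y)) | x y. (x, y) \<in> parcs G2}
                 \<union> {(Inr (Inr x), Inr (Inr y)) | x y. (x, y) \<in> parcs G3}
                 \<union> J \<union> J\<inverse> \<rparr>)"

end

theory Submission
  imports Defs
begin

text \<open>
  The original vertices \<open>U\<close>, the edge vertices \<open>W\<close>, and the vertices \<open>X\<close>, \<open>Y\<close> of the second and
  third graph split the eccentricity matrix into \<open>4 \<times> 4\<close> blocks.  Every vertex has
  eccentricity 2 (in \<open>U\<close>, \<open>W\<close>) or 3 (in \<open>X\<close>, \<open>Y\<close>), and the matrix is \<open>E\<^sub>0 + P L\<close>, where \<open>P\<close> is the
  indicator matrix of the cells, \<open>L\<close> is constant on each cell, and \<open>E\<^sub>0\<close> only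
  involves the adjacency matrix \<open>A\<close> and the incidence matrix \<open>M\<close> of the first graph:
  \<open>2A\<close> on \<open>UU\<close>, \<open>-2M\<close> on \<open>UW\<close> and \<open>-2\<close> times the identity on \<open>WW\<close>.  By regularity
  \<open>E\<^sub>0 P = P D\<close> for a \<open>4 \<times> 4\<close> matrix \<open>D\<close>, which gives
  \<open>\<chi>(E\<^sub>0 + P L) \<chi>(D) = \<chi>(E\<^sub>0) \<chi>(D + L P)\<close>, and \<open>D + L P\<close> is the matrix in (4).
  A Schur complement and \<open>M M\<^sup>T = A + r I\<close> express \<open>\<chi>(E\<^sub>0)\<close> through \<open>\<chi>(A)\<close>; the factor of the
  trivial eigenvalue \<open>\<lambda>\<^sub>1 = r\<close> cancels against \<open>\<chi>(D)\<close>.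
\<close>

section \<open>Determinants of matrices indexed by lists\<close>

text \<open>Indexing rows and columns by vertices instead of numbers turns a matrix product into a
  sum over a vertex set and a concatenation of lists into a block decomposition.\<close>

definition list_mat :: "('i \<Rightarrow> 'j \<Rightarrow> 'k) \<Rightarrow> 'i list \<Rightarrow> 'j list \<Rightarrow> 'k mat" where
  "list_mat f xs ys = mat (length xs) (length ys) (\<lambda>(i, j). f (xs ! i) (ys ! j))"

lemma list_mat_carrier [simp, intro]: "list_mat f xs ys \<in> carrier_mat (length xs) (length ys)"
  and list_mat_dim [simp]: "dim_row (list_mat f xs ys) = length xs"
    "dim_col (list_mat f xs ys) = length ys"
  and list_mat_index [simp]: "i < length xs \<Longrightarrow> j < length ys \<Longrightarrow>
    list_mat f xs ys $$ (i, j) = f (xs ! i) (ys ! j)"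
  by (simp_all add: list_mat_def)

lemma list_mat_cong:
  assumes "\<And>x y. x \<in> set xs \<Longrightarrow> y \<in> set ys \<Longrightarrow> f x y = g x y"
  shows "list_mat f xs ys = list_mat g xs ys"
  by (rule eq_matI) (auto simp: assms)

lemma list_mat_map: "list_mat f (map g xs) (map h ys) = list_mat (\<lambda>x y. f (g x) (h y)) xs ys"
  by (rule eq_matI) auto

lemma map_mat_list_mat: "map_mat h (list_mat f xs ys) = list_mat (\<lambda>x y. h (f x y)) xs ys"
  by (rule eq_matI) auto

lemma list_mat_mult:
  assumes "distinct ys"
  shows "list_mat f xs ys * list_mat g ys zs = list_mat (\<lambda>x z. \<Sum>y\<in>set ys. f x y * g y z) xs zs"
proof (rule eq_matI)
  fix i j assume ij: "i < dim_row (list_mat (\<lambda>x z. \<Sum>y\<in>set ys. f x y * g y z) xs zs)"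
    "j < dim_col (list_mat (\<lambda>x z. \<Sum>y\<in>set ys. f x y * g y z) xs zs)"
  have "(\<Sum>y\<in>set ys. f (xs ! i) y * g y (zs ! j)) =
      (\<Sum>k = 0..<length ys. f (xs ! i) (ys ! k) * g (ys ! k) (zs ! j))"
    by (subst sum.distinct_set_conv_list[OF assms], subst sum_list_sum_nth) simp
  then show "(list_mat f xs ys * list_mat g ys zs) $$ (i, j) =
      list_mat (\<lambda>x z. \<Sum>y\<in>set ys. f x y * g y z) xs zs $$ (i, j)"
    using ij by (simp add: scalar_prod_def)
qed auto

lemma list_mat_minus:
  "list_mat f xs ys - list_mat g xs ys = list_mat (\<lambda>x y. f x y - g x y :: 'a :: ab_group_add) xs ys"
  by (rule eq_matI) auto

lemma list_mat_smult: "c \<cdot>\<^sub>m list_mat f xs ys = list_mat (\<lambda>x y. c * f x y) xs ys"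
  by (rule eq_matI) auto

lemma one_mat_list_mat:
  "distinct xs \<Longrightarrow> 1\<^sub>m (length xs) = list_mat (\<lambda>x y. if x = y then 1 else 0) xs xs"
  by (rule eq_matI) (auto simp: nth_eq_iff_index_eq)

lemma list_mat_append:
  "list_mat f (xs @ xs') (ys @ ys') =
     four_block_mat (list_mat f xs ys) (list_mat f xs ys') (list_mat f xs' ys) (list_mat f xs' ys')"
  by (rule eq_matI) (auto simp: nth_append)

text \<open>Reordering the index list permutes rows and columns simultaneously, so the sign of the
  permutation enters twice and cancels. An arbitrary enumeration of the join can thus be replaced by
  one sorted by cells.\<close>

lemma det_list_mat_perm:
  assumes "mset xs = mset ys"
  shows "det (list_mat f xs xs) = det (list_mat f ys ys)"
proof -
  obtain p where p: "p permutes {..<length ys}" and xs: "permute_list p ys = xs"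
    using mset_eq_permutation[OF assms] by blast
  define n where "n = length ys"
  have p': "p permutes {0..<n}" using p by (simp add: n_def atLeast0LessThan)
  have pn: "i < n \<Longrightarrow> p i < n" for i using permutes_in_image[OF p'] by auto
  let ?A = "list_mat f ys ys"
  have A: "?A \<in> carrier_mat n n" by (simp add: n_def)
  let ?B = "mat n n (\<lambda>(i, j). ?A $$ (p i, j))"
  have B: "transpose_mat ?B \<in> carrier_mat n n" by simp
  \<comment> \<open>The column permutation is a row permutation of the transpose, so
    \<open>det_permute_rows\<close> serves for both.\<close>
  have "list_mat f xs xs = transpose_mat (mat n n (\<lambda>(i, j). transpose_mat ?B $$ (p i, j)))"
    using p pn unfolding xs[symmetric]
    by (intro eq_matI) (auto simp: n_def permute_list_nth)
  also have "det \<dots> = det (mat n n (\<lambda>(i, j). transpose_mat ?B $$ (p i, j)))"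
    by (rule det_transpose) auto
  also have "\<dots> = signof p * det (transpose_mat ?B)"
    by (rule det_permute_rows[OF B p'])
  also have "det (transpose_mat ?B) = det ?B" by (rule det_transpose) auto
  also have "\<dots> = signof p * det ?A" by (rule det_permute_rows[OF A p'])
  finally show ?thesis by (simp add: sign_def)
qed

text \<open>Characteristic polynomials are handled through their values at a scalar
  \<open>t\<close>, which keeps all determinants over the field itself; \<open>poly_ext\<close>
  returns to polynomials at the end.\<close>

lemma poly_char_poly_list_mat:
  fixes f :: "'i \<Rightarrow> 'i \<Rightarrow> 'a :: field"
  assumes "distinct xs"
  shows "poly (char_poly (list_mat f xs xs)) t =
    det (list_mat (\<lambda>x y. (if x = y then t else 0) - f x y) xs xs)"
proof -
  have "- char_matrix (list_mat f xs xs) t =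
      list_mat (\<lambda>x y. (if x = y then t else 0) - f x y) xs xs"
    unfolding char_matrix_def using assms
    by (intro eq_matI) (auto simp: nth_eq_iff_index_eq)
  then show ?thesis
    by (subst char_poly_matrix[of _ "length xs"]) auto
qed

lemma det_list_mat_scalar:
  assumes "distinct xs"
  shows "det (list_mat (\<lambda>x y. if x = y then s else 0 :: 'a :: comm_ring_1) xs xs) = s ^ length xs"
proof -
  have "list_mat (\<lambda>x y. if x = y then s else 0) xs xs = s \<cdot>\<^sub>m 1\<^sub>m (length xs)"
    using assms by (intro eq_matI) (auto simp: nth_eq_iff_index_eq)
  then show ?thesis by simp
qed

text \<open>
  Both sides are the determinant of the bordered matrix \<open>[[X, P], [L, 1]]\<close> times \<open>det Y\<close>: clear
  \<open>L\<close> by column operations on one side, multiply by \<open>[[1, -P], [0, Y]]\<close> on the other.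
\<close>

lemma det_intertwined_update:
  fixes X :: "'a :: idom mat"
  assumes X [simp]: "X \<in> carrier_mat n n" and P [simp]: "P \<in> carrier_mat n k"
    and L [simp]: "L \<in> carrier_mat k n" and Y [simp]: "Y \<in> carrier_mat k k"
    and XP: "X * P = P * Y"
  shows "det (X - P * L) * det Y = det X * det (Y - L * P)"
proof -
  let ?Z = "four_block_mat X P L (1\<^sub>m k)"
  let ?C1 = "four_block_mat (1\<^sub>m n) (0\<^sub>m n k) (- L) (1\<^sub>m k)"
  let ?C2 = "four_block_mat (1\<^sub>m n) (- P) (0\<^sub>m k n) Y"
  have Z: "?Z \<in> carrier_mat (n + k) (n + k)" "?C1 \<in> carrier_mat (n + k) (n + k)"
    "?C2 \<in> carrier_mat (n + k) (n + k)" by auto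
  have PY [simp]: "P * Y \<in> carrier_mat n k" by (rule mult_carrier_mat[OF P Y])
  have LP [simp]: "L * P \<in> carrier_mat k k" by (rule mult_carrier_mat[OF L P])
  have PL [simp]: "P * L \<in> carrier_mat n n" by (rule mult_carrier_mat[OF P L])
  have dims [simp]: "dim_row L = k" "dim_col L = n" "dim_row P = n" "dim_col P = k"
    "dim_row X = n" "dim_col X = n" "dim_row Y = k" "dim_col Y = k"
    using X P L Y by (metis carrier_matD)+
  have "?Z * ?C1 = four_block_mat (X * 1\<^sub>m n + P * - L) (X * 0\<^sub>m n k + P * 1\<^sub>m k)
        (L * 1\<^sub>m n + 1\<^sub>m k * - L) (L * 0\<^sub>m n k + 1\<^sub>m k * 1\<^sub>m k)"
    by (rule mult_four_block_mat[of _ n n _ k _ k]) auto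
  also have "X * 1\<^sub>m n + P * - L = X - P * L"
    by (simp add: minus_add_uminus_mat[of _ n n])
  also have "X * 0\<^sub>m n k + P * 1\<^sub>m k = P" by simp
  also have "L * 1\<^sub>m n + 1\<^sub>m k * - L = 0\<^sub>m k n"
    by (rule eq_matI) auto
  also have "L * 0\<^sub>m n k + 1\<^sub>m k * 1\<^sub>m k = 1\<^sub>m k" by simp
  finally have 1: "?Z * ?C1 = four_block_mat (X - P * L) P (0\<^sub>m k n) (1\<^sub>m k)" .
  have "?Z * ?C2 = four_block_mat (X * 1\<^sub>m n + P * 0\<^sub>m k n) (X * - P + P * Y)
        (L * 1\<^sub>m n + 1\<^sub>m k * 0\<^sub>m k n) (L * - P + 1\<^sub>m k * Y)"
    by (rule mult_four_block_mat[of _ n n _ k _ k]) auto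
  also have "X * 1\<^sub>m n + P * 0\<^sub>m k n = X" by simp
  also have "X * - P + P * Y = 0\<^sub>m n k"
    by (rule eq_matI) (auto simp: XP)
  also have "L * 1\<^sub>m n + 1\<^sub>m k * 0\<^sub>m k n = L" by simp
  also have "L * - P + 1\<^sub>m k * Y = Y - L * P"
    by (rule eq_matI) auto
  finally have 2: "?Z * ?C2 = four_block_mat X (0\<^sub>m n k) L (Y - L * P)" .
  have "det ?Z * det ?C1 = det (?Z * ?C1)" by (rule det_mult[symmetric, OF Z(1,2)])
  also have "det (?Z * ?C1) = det (X - P * L)"
    unfolding 1 by (subst det_four_block_mat_lower_left_zero[of _ n _ k]) auto
  also have "det ?C1 = 1"
    by (subst det_four_block_mat_upper_right_zero[of _ n _ k]) auto
  finally have Z1: "det ?Z = det (X - P * L)" by simp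
  have "det ?Z * det ?C2 = det (?Z * ?C2)" by (rule det_mult[symmetric, OF Z(1,3)])
  also have "det (?Z * ?C2) = det X * det (Y - L * P)"
    unfolding 2 by (subst det_four_block_mat_upper_right_zero[of _ n _ k]) auto
  also have "det ?C2 = det Y"
    by (subst det_four_block_mat_lower_left_zero[of _ n _ k]) auto
  finally show ?thesis unfolding Z1 .
qed

text \<open>The Schur complement without division: right multiplication by \<open>?R\<close> clears
  the lower left block, and the powers of \<open>s\<close> stay as factors, so \<open>s = 0\<close>
  is allowed. It is applied with \<open>s = t + 2\<close>, which vanishes at
  \<open>t = -2\<close>.\<close>

lemma det_four_block_scalar:
  fixes A :: "'a :: idom mat"
  assumes A: "A \<in> carrier_mat m m" and B: "B \<in> carrier_mat m k" and C: "C \<in> carrier_mat k m"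
  shows "det (four_block_mat A B C (s \<cdot>\<^sub>m 1\<^sub>m k)) * s ^ m = det (s \<cdot>\<^sub>m A - B * C) * s ^ k"
proof -
  let ?Z = "four_block_mat A B C (s \<cdot>\<^sub>m 1\<^sub>m k)"
  let ?R = "four_block_mat (s \<cdot>\<^sub>m 1\<^sub>m m) (0\<^sub>m m k) (- C) (1\<^sub>m k)"
  have Z: "?Z \<in> carrier_mat (m + k) (m + k)" "?R \<in> carrier_mat (m + k) (m + k)" using A by auto
  have BC [simp]: "B * C \<in> carrier_mat m m" by (rule mult_carrier_mat[OF B C])
  have dims [simp]: "dim_row A = m" "dim_col A = m" "dim_row B = m" "dim_col B = k"
    "dim_row C = k" "dim_col C = m"
    using A B C by auto
  have "?Z * ?R = four_block_mat (A * (s \<cdot>\<^sub>m 1\<^sub>m m) + B * - C) (A * 0\<^sub>m m k + B * 1\<^sub>m k)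
        (C * (s \<cdot>\<^sub>m 1\<^sub>m m) + (s \<cdot>\<^sub>m 1\<^sub>m k) * - C) (C * 0\<^sub>m m k + (s \<cdot>\<^sub>m 1\<^sub>m k) * 1\<^sub>m k)"
    by (rule mult_four_block_mat[OF A B C]) (use C in auto)
  also have "A * (s \<cdot>\<^sub>m 1\<^sub>m m) = s \<cdot>\<^sub>m A"
    using A by (subst mult_smult_distrib[of _ m m]) auto
  also have "B * - C = - (B * C)" using dims by simp
  also have "s \<cdot>\<^sub>m A + - (B * C) = s \<cdot>\<^sub>m A - B * C"
    using A by (subst minus_add_uminus_mat[of _ m m]) auto
  also have "A * 0\<^sub>m m k + B * 1\<^sub>m k = B" using A B by simp
  also have "C * (s \<cdot>\<^sub>m 1\<^sub>m m) = s \<cdot>\<^sub>m C"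
    using C by (subst mult_smult_distrib[of _ k m]) auto
  also have "(s \<cdot>\<^sub>m 1\<^sub>m k) * - C = s \<cdot>\<^sub>m (- C)"
    using C by (subst mult_smult_assoc_mat[of _ k k]) auto
  also have "s \<cdot>\<^sub>m C + s \<cdot>\<^sub>m (- C) = 0\<^sub>m k m" by (rule eq_matI) auto
  also have "(s \<cdot>\<^sub>m 1\<^sub>m k) * 1\<^sub>m k = s \<cdot>\<^sub>m 1\<^sub>m k" by simp
  also have "C * 0\<^sub>m m k + s \<cdot>\<^sub>m 1\<^sub>m k = s \<cdot>\<^sub>m 1\<^sub>m k" using C by simp
  finally have 1: "?Z * ?R = four_block_mat (s \<cdot>\<^sub>m A - B * C) B (0\<^sub>m k m) (s \<cdot>\<^sub>m 1\<^sub>m k)" .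
  have "det ?Z * det ?R = det (?Z * ?R)" by (rule det_mult[symmetric, OF Z])
  also have "det (?Z * ?R) = det (s \<cdot>\<^sub>m A - B * C) * s ^ k"
    unfolding 1 by (subst det_four_block_mat_lower_left_zero[OF _ B refl]) auto
  also have "det ?R = s ^ m"
    by (subst det_four_block_mat_upper_right_zero[of _ m _ k]) (auto simp: C)
  finally show ?thesis .
qed

section \<open>Eigenvalues and factored characteristic polynomials\<close>

lemma char_poly_eq_prod_roots:
  fixes A :: "complex mat"
  assumes "A \<in> carrier_mat n n" "proots (char_poly A) = image_mset lam (mset_set I)"
  shows "char_poly A = (\<Prod>i\<in>I. [:- lam i, 1:])"
proof -
  have "char_poly A = (\<Prod>x\<in>#proots (char_poly A). [:- x, 1:])"
    using complex_poly_decompose_multiset[of "char_poly A"] degree_monic_char_poly[OF assms(1)] by simp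
  then show ?thesis by (simp add: assms(2) prod_unfold_prod_mset multiset.map_comp comp_def)
qed

text \<open>For \<open>d \<noteq> 0\<close> the matrix is \<open>d\<close> times
  \<open>(c / d) I - A\<close>, whose determinant is a value of \<open>char_poly A\<close>. The case
  \<open>d = 0\<close> is included because \<open>d = 2 * t + 8\<close> is used for every
  \<open>t\<close>.\<close>

lemma det_smult_minus_smult:
  fixes A :: "'a :: field mat"
  assumes A: "A \<in> carrier_mat n n" and chi: "char_poly A = (\<Prod>i\<in>I. [:- lam i, 1:])"
  shows "det (c \<cdot>\<^sub>m 1\<^sub>m n - d \<cdot>\<^sub>m A) = (\<Prod>i\<in>I. c - d * lam i)"
proof -
  \<comment> \<open>Comparing degrees shows that \<open>n\<close> counts the factors, so powers
    \<open>c ^ n\<close> and \<open>d ^ n\<close> can be distributed over the product.\<close>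
  have "n = degree (char_poly A)" using degree_monic_char_poly[OF A] by simp
  also have "\<dots> = card I" unfolding chi by (subst degree_prod_sum_eq) auto
  finally have n: "n = card I" .
  show ?thesis
  proof (cases "d = 0")
    case True
    have "c \<cdot>\<^sub>m 1\<^sub>m n - d \<cdot>\<^sub>m A = c \<cdot>\<^sub>m 1\<^sub>m n" using A True by (intro eq_matI) auto
    then show ?thesis using True n by simp
  next
    case False
    have "c \<cdot>\<^sub>m 1\<^sub>m n - d \<cdot>\<^sub>m A = d \<cdot>\<^sub>m (- char_matrix A (c / d))"
      using A False by (intro eq_matI) (auto simp: char_matrix_def field_simps)
    also have "det \<dots> = d ^ n * poly (char_poly A) (c / d)"
      using A by (simp add: char_poly_matrix[OF A] char_matrix_def)
    also have "\<dots> = (\<Prod>i\<in>I. d * (c / d - lam i))"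
      by (simp add: chi poly_prod prod.distrib n)
    also have "\<dots> = (\<Prod>i\<in>I. c - d * lam i)"
      using False by (intro prod.cong) (auto simp: field_simps)
    finally show ?thesis .
  qed
qed

text \<open>A Gershgorin argument: the eigenvalue equation is read off at a coordinate where the
  eigenvector has maximal modulus.\<close>

lemma cmod_eigenvalue_le_row_sum:
  fixes A :: "complex mat"
  assumes A: "A \<in> carrier_mat n n" and ev: "eigenvalue A z"
    and row: "\<And>i. i < n \<Longrightarrow> (\<Sum>j<n. cmod (A $$ (i, j))) \<le> r"
  shows "cmod z \<le> r"
proof -
  obtain v where v: "v \<in> carrier_vec n" "v \<noteq> 0\<^sub>v n" "A *\<^sub>v v = z \<cdot>\<^sub>v v"
    using ev A unfolding eigenvalue_def eigenvector_def by auto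
  have ne: "{..<n} \<noteq> {}"
    using v(1,2) by (auto simp: lessThan_empty_iff)
  obtain i where i: "i < n" and max: "\<And>j. j < n \<Longrightarrow> cmod (v $ j) \<le> cmod (v $ i)"
  proof -
    have "finite ((\<lambda>j. cmod (v $ j)) ` {..<n})" "(\<lambda>j. cmod (v $ j)) ` {..<n} \<noteq> {}"
      using ne by auto
    from Max_in[OF this] obtain i where "i < n" "Max ((\<lambda>j. cmod (v $ j)) ` {..<n}) = cmod (v $ i)"
      by (metis (no_types, lifting) imageE lessThan_iff)
    moreover have "cmod (v $ j) \<le> Max ((\<lambda>j. cmod (v $ j)) ` {..<n})" if "j < n" for j
      using that by (intro Max_ge) auto
    ultimately show thesis using that[of i] by simp
  qed
  have pos: "cmod (v $ i) > 0"
  proof (rule ccontr)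
    assume "\<not> ?thesis"
    then have "\<And>j. j < n \<Longrightarrow> v $ j = 0" using max by force
    then have "v = 0\<^sub>v n" using v(1) by (intro eq_vecI) auto
    then show False using v(2) by simp
  qed
  have "z * v $ i = (z \<cdot>\<^sub>v v) $ i" using i v(1) by simp
  also have "\<dots> = (\<Sum>j<n. A $$ (i, j) * v $ j)"
    unfolding v(3)[symmetric] using i v(1) A
    by (simp add: scalar_prod_def atLeast0LessThan)
  finally have "cmod z * cmod (v $ i) = cmod (\<Sum>j<n. A $$ (i, j) * v $ j)"
    by (metis norm_mult)
  also have "\<dots> \<le> (\<Sum>j<n. cmod (A $$ (i, j)) * cmod (v $ j))"
    by (rule order_trans[OF norm_sum]) (simp add: norm_mult)
  also have "\<dots> \<le> (\<Sum>j<n. cmod (A $$ (i, j)) * cmod (v $ i))"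
    using max by (intro sum_mono mult_left_mono) auto
  also have "\<dots> \<le> r * cmod (v $ i)"
    using row[OF i] pos by (simp add: sum_distrib_right[symmetric])
  finally show ?thesis using pos by simp
qed

text \<open>The all-ones vector is an eigenvector; \<open>n > 0\<close> makes it nonzero.\<close>

lemma eigenvalue_constant_row_sum:
  fixes A :: "'a :: field mat"
  assumes A: "A \<in> carrier_mat n n" "n > 0" and row: "\<And>i. i < n \<Longrightarrow> (\<Sum>j<n. A $$ (i, j)) = r"
  shows "eigenvalue A r"
proof -
  have "A *\<^sub>v vec n (\<lambda>_. 1) = r \<cdot>\<^sub>v vec n (\<lambda>_. 1)"
    using A row by (intro eq_vecI) (auto simp: scalar_prod_def atLeast0LessThan)
  moreover have "vec n (\<lambda>_. 1) $ 0 \<noteq> (0\<^sub>v n $ 0 :: 'a)" using A(2) by simp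
  then have "vec n (\<lambda>_. 1) \<noteq> (0\<^sub>v n :: 'a vec)" by metis
  ultimately show ?thesis
    using A unfolding eigenvalue_def eigenvector_def by (intro exI[of _ "vec n (\<lambda>_. 1)"]) auto
qed

section \<open>Distances and regular graphs\<close>

context wf_digraph
begin

lemma awalk_cost_one: "awalk_cost (\<lambda>_. 1) p = real (length p)"
  by (induction p) auto

lemma mu_one_le: "awalk u p v \<Longrightarrow> \<mu> (\<lambda>_. 1) u v \<le> ereal (real (length p))"
  using min_cost_le_walk_cost[of u p v "\<lambda>_. 1"] by (simp add: awalk_cost_one)

lemma mu_one_ge:
  assumes "\<And>p. awalk u p v \<Longrightarrow> k \<le> length p"
  shows "ereal (real k) \<le> \<mu> (\<lambda>_. 1) u v"
  unfolding \<mu>_def by (rule INF_greatest) (use assms in \<open>auto simp: awalk_cost_one\<close>)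

end

context pair_wf_digraph
begin

lemma graph_dist_self: "u \<in> pverts G \<Longrightarrow> graph_dist G u u = 0"
  unfolding graph_dist_def
  using mu_one_le[of u "[]" u] mu_one_ge[of u u 0]
  by (auto simp: awalk_Nil_iff zero_ereal_def intro!: antisym)

lemma graph_dist_arc:
  assumes "(u, v) \<in> parcs G" "u \<noteq> v"
  shows "graph_dist G u v = 1"
proof -
  have "1 \<le> length p" if "awalk u p v" for p
    using that assms(2) by (cases p) (auto simp: awalk_Nil_iff)
  then show ?thesis
    unfolding graph_dist_def
    using mu_one_le[of u "[(u, v)]" v] mu_one_ge[of u v 1] assms(1)
    by (auto simp: awalk_simps one_ereal_def wellformed' intro!: antisym)
qed

text \<open>An explicit walk bounds the distance from above, and the hypotheses on arcs rule out
  every shorter walk. The other distance lemmas follow the same pattern.\<close>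

lemma graph_dist_two:
  assumes "(u, v) \<notin> parcs G" "u \<noteq> v" "(u, w) \<in> parcs G" "(w, v) \<in> parcs G"
  shows "graph_dist G u v = 2"
proof -
  have "2 \<le> length p" if "awalk u p v" for p
    using that assms(1,2)
    \<comment> \<open>The simultaneous split on \<open>p\<close> and \<open>tl p\<close> separates
      walks with no arc, one arc and at least two arcs.\<close>
    by (cases p rule: list.exhaust[case_product list.exhaust[of "tl p"]]) (auto simp: awalk_simps)
  then show ?thesis
    unfolding graph_dist_def
    using mu_one_le[of u "[(u, w), (w, v)]" v] mu_one_ge[of u v 2] assms(3,4)
    by (auto simp: awalk_simps wellformed' intro!: antisym)
qed

lemma graph_dist_three:
  assumes "(u, v) \<notin> parcs G" "u \<noteq> v" "\<And>w. (u, w) \<in> parcs G \<Longrightarrow> (w, v) \<notin> parcs G"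
    and "(u, x) \<in> parcs G" "(x, y) \<in> parcs G" "(y, v) \<in> parcs G"
  shows "graph_dist G u v = 3"
proof -
  have "3 \<le> length p" if p: "awalk u p v" for p
  proof (rule ccontr)
    assume "\<not> ?thesis"
    then consider "p = []" | e where "p = [e]" | e f where "p = [e, f]"
      by (cases p; cases "tl p"; cases "tl (tl p)") auto
    then show False using p assms(1-3) by cases (auto simp: awalk_simps)
  qed
  then show ?thesis
    unfolding graph_dist_def
    using mu_one_le[of u "[(u, x), (x, y), (y, v)]" v] mu_one_ge[of u v 3] assms(4-6)
    by (auto simp: awalk_simps wellformed' intro!: antisym)
qed

end

section \<open>Edges and degrees in symmetric loop-free graphs\<close>

lemma finite_edges: "finite (parcs G) \<Longrightarrow> finite (edges G)"
proof -
  assume "finite (parcs G)"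
  moreover have "edges G = (\<lambda>(u, v). {u, v}) ` parcs G" by (auto simp: edges_def)
  ultimately show ?thesis by simp
qed

context pair_graph
begin

lemma parcs_sym: "(u, v) \<in> parcs G \<Longrightarrow> (v, u) \<in> parcs G"
  using arcs_ends_symmetric[OF sym_arcs] by simp

lemma edge_iff: "{u, v} \<in> edges G \<longleftrightarrow> (u, v) \<in> parcs G"
  by (auto simp: edges_def doubleton_eq_iff dest: parcs_sym)

lemma edge_subset_pverts: "e \<in> edges G \<Longrightarrow> e \<subseteq> pverts G"
  by (auto simp: edges_def dest: in_arcsD1 in_arcsD2)

lemma edge_obtain:
  assumes "e \<in> edges G"
  obtains u v where "e = {u, v}" "(u, v) \<in> parcs G" "(v, u) \<in> parcs G" "u \<noteq> v"
  using assms by (auto simp: edges_def dest: parcs_sym no_loops')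

lemma card_edge: "e \<in> edges G \<Longrightarrow> card e = 2"
  by (erule edge_obtain) auto

lemma card_neighbours:
  assumes "regular G r" "u \<in> pverts G"
  shows "card {v. (u, v) \<in> parcs G} = r"
proof -
  have "out_arcs (with_proj G) u = Pair u ` {v. (u, v) \<in> parcs G}"
    by (auto simp: out_arcs_def)
  then have "card (out_arcs (with_proj G) u) = card {v. (u, v) \<in> parcs G}"
    by (simp add: card_image inj_on_def)
  then show ?thesis using assms by (auto simp: regular_def out_degree_def)
qed

text \<open>Edges at \<open>u\<close> correspond to neighbours of \<open>u\<close> by sending
  \<open>v\<close> to \<open>{u, v}\<close>. This count is the diagonal of
  \<open>M M\<^sup>T\<close>.\<close>

lemma card_incident_edges:
  assumes "regular G r" "u \<in> pverts G"
  shows "card {e \<in> edges G. u \<in> e} = r"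
proof -
  have "{e \<in> edges G. u \<in> e} = (\<lambda>v. {u, v}) ` {v. (u, v) \<in> parcs G}"
    by (auto simp: edge_iff elim!: edge_obtain)
  moreover have "inj_on (\<lambda>v. {u, v}) {v. (u, v) \<in> parcs G}"
    by (auto simp: inj_on_def doubleton_eq_iff)
  ultimately show ?thesis using card_neighbours[OF assms] by (simp add: card_image)
qed

text \<open>In a simple graph two vertices share at most one edge, which makes the off-diagonal part
  of \<open>M M\<^sup>T\<close> equal to \<open>A\<close>.\<close>

lemma edges_containing_pair:
  assumes "u \<noteq> v"
  shows "{e \<in> edges G. u \<in> e \<and> v \<in> e} = (if (u, v) \<in> parcs G then {{u, v}} else {})"
  using assms by (auto simp: edge_iff elim!: edge_obtain)

text \<open>A walk from \<open>u\<close> to any second vertex is nonempty, and its first arc leads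
  to a neighbour of \<open>u\<close>.\<close>

lemma connected_ex_neighbour:
  assumes con: "connected (with_proj G)" and "2 \<le> card (pverts G)" and u: "u \<in> pverts G"
  shows "\<exists>v. (u, v) \<in> parcs G"
proof -
  obtain v where v: "v \<in> pverts G" "v \<noteq> u"
  proof (rule ccontr)
    assume "\<not> thesis"
    then have "pverts G \<subseteq> {u}" using that by blast
    then have "card (pverts G) \<le> card {u}" by (intro card_mono) auto
    then show False using assms(2) by simp
  qed
  have "u \<rightarrow>\<^sup>*\<^bsub>mk_symmetric (with_proj G)\<^esub> v"
    using con u v(1) unfolding connected_def strongly_connected_def by auto
  \<comment> \<open>Connectedness speaks of the symmetric closure; the arcs are already symmetric,
    so reachability is the same.\<close>
  then have "u \<rightarrow>\<^sup>*\<^bsub>with_proj G\<^esub> v"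
    using reachable_mk_symmetric_eq[OF sym_arcs] by simp
  then obtain p where "awalk u p v" using reachable_awalk by auto
  with v(2) show ?thesis by (cases p) (auto simp: awalk_simps)
qed

lemma connected_pverts_nonempty: "connected (with_proj G) \<Longrightarrow> pverts G \<noteq> {}"
  unfolding connected_def strongly_connected_def by auto

end

section \<open>The eccentricity matrix of the join\<close>

text \<open>
  \<open>local_part\<close> is \<open>E\<^sub>0\<close>, \<open>L\<close> has entry \<open>cell_weight k (cell b)\<close> in row \<open>k\<close> and column \<open>b\<close>, and
  \<open>quotient_local\<close> below is \<open>D\<close>; the cells \<open>U\<close>, \<open>W\<close>, \<open>X\<close>, \<open>Y\<close> are numbered 0 to 3.
\<close>

fun cell :: "('a + 'e) + ('b + 'c) \<Rightarrow> nat" where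
  "cell (Inl (Inl u)) = 0"
| "cell (Inl (Inr e)) = 1"
| "cell (Inr (Inl x)) = 2"
| "cell (Inr (Inr y)) = 3"

definition cell_weight :: "nat \<Rightarrow> nat \<Rightarrow> real" where
  "cell_weight i j = [[0, 2, 0, 2], [2, 2, 2, 0], [0, 2, 0, 3], [2, 0, 3, 0]] ! i ! j"

fun local_part :: "'a rel \<Rightarrow> ('a + 'a set) + ('b + 'c) \<Rightarrow> ('a + 'a set) + ('b + 'c) \<Rightarrow> real" where
  "local_part R (Inl (Inl u)) (Inl (Inl v)) = (if (u, v) \<in> R then 2 else 0)"
| "local_part R (Inl (Inl u)) (Inl (Inr e)) = (if u \<in> e then -2 else 0)"
| "local_part R (Inl (Inr e)) (Inl (Inl u)) = (if u \<in> e then -2 else 0)"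
| "local_part R (Inl (Inr e)) (Inl (Inr f)) = (if e = f then -2 else 0)"
| "local_part R _ _ = 0"

lemma vertex_cases:
  obtains u where "a = Inl (Inl u)" | e where "a = Inl (Inr e)"
  | x where "a = Inr (Inl x)" | y where "a = Inr (Inr y)"
  by (metis sumE)

lemma sum_join:
  assumes "finite A" "finite B" "finite C" "finite D"
  shows "sum f ((A <+> B) <+> (C <+> D)) =
    (\<Sum>u\<in>A. f (Inl (Inl u))) + (\<Sum>e\<in>B. f (Inl (Inr e))) +
    ((\<Sum>x\<in>C. f (Inr (Inl x))) + (\<Sum>y\<in>D. f (Inr (Inr y))))"
  using assms by (simp add: sum.Plus comp_def)

text \<open>Connectedness and \<open>2 \<le> p1\<close> enter through the consequences that the
  distance computations use: \<open>ex_neighbour\<close> and \<open>nonempty\<close>.\<close>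

locale central_join =
  G1: pair_graph G1 + G2: pair_graph G2 + G3: pair_graph G3
  for G1 :: "'a pair_pre_digraph" and G2 :: "'b pair_pre_digraph" and G3 :: "'c pair_pre_digraph" +
  fixes r :: nat
  assumes regular: "regular G1 r"
    and triangle_free: "triangle_free G1"
    and ex_neighbour: "\<And>u. u \<in> pverts G1 \<Longrightarrow> \<exists>v. (u, v) \<in> parcs G1"
    and nonempty: "pverts G1 \<noteq> {}" "pverts G2 \<noteq> {}" "pverts G3 \<noteq> {}"
begin

definition J where "J = central_vertex_edge_join G1 G2 G3"

lemma pverts_J: "pverts J = (pverts G1 <+> edges G1) <+> (pverts G2 <+> pverts G3)"
  by (simp add: J_def central_vertex_edge_join_def central_graph_def Let_def)

lemma finite_edges_G1: "finite (edges G1)"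
  by (rule finite_edges) (rule G1.pair_finite_arcs)

lemma finite_pverts_J: "finite (pverts J)"
  by (simp add: pverts_J finite_edges_G1)

lemma pverts_J_iff [simp]:
  "Inl (Inl u) \<in> pverts J \<longleftrightarrow> u \<in> pverts G1"
  "Inl (Inr e) \<in> pverts J \<longleftrightarrow> e \<in> edges G1"
  "Inr (Inl x) \<in> pverts J \<longleftrightarrow> x \<in> pverts G2"
  "Inr (Inr y) \<in> pverts J \<longleftrightarrow> y \<in> pverts G3"
  by (auto simp: pverts_J)

text \<open>All sixteen pairs of cells are listed, so that after \<open>vertex_cases\<close>
  simplification decides every adjacency in the join.\<close>

lemma parcs_J_iff [simp]:
  "(Inl (Inl u), Inl (Inl v)) \<in> parcs J \<longleftrightarrow>
     u \<in> pverts G1 \<and> v \<in> pverts G1 \<and> u \<noteq> v \<and> (u, v) \<notin> parcs G1"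
  "(Inl (Inl u), Inl (Inr e)) \<in> parcs J \<longleftrightarrow> e \<in> edges G1 \<and> u \<in> e"
  "(Inl (Inr e), Inl (Inl u)) \<in> parcs J \<longleftrightarrow> e \<in> edges G1 \<and> u \<in> e"
  "(Inl (Inr e), Inl (Inr f)) \<notin> parcs J"
  "(Inl (Inl u), Inr (Inl x)) \<in> parcs J \<longleftrightarrow> u \<in> pverts G1 \<and> x \<in> pverts G2"
  "(Inr (Inl x), Inl (Inl u)) \<in> parcs J \<longleftrightarrow> u \<in> pverts G1 \<and> x \<in> pverts G2"
  "(Inl (Inl u), Inr (Inr y)) \<notin> parcs J"
  "(Inr (Inr y), Inl (Inl u)) \<notin> parcs J"
  "(Inl (Inr e), Inr (Inl x)) \<notin> parcs J"
  "(Inr (Inl x), Inl (Inr e)) \<notin> parcs J"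
  "(Inl (Inr e), Inr (Inr y)) \<in> parcs J \<longleftrightarrow> e \<in> edges G1 \<and> y \<in> pverts G3"
  "(Inr (Inr y), Inl (Inr e)) \<in> parcs J \<longleftrightarrow> e \<in> edges G1 \<and> y \<in> pverts G3"
  "(Inr (Inl x), Inr (Inl x')) \<in> parcs J \<longleftrightarrow> (x, x') \<in> parcs G2"
  "(Inr (Inl x), Inr (Inr y)) \<notin> parcs J"
  "(Inr (Inr y), Inr (Inl x)) \<notin> parcs J"
  "(Inr (Inr y), Inr (Inr y')) \<in> parcs J \<longleftrightarrow> (y, y') \<in> parcs G3"
  by (auto simp: J_def central_vertex_edge_join_def central_graph_def Let_def)

sublocale J: pair_wf_digraph J
proof -
  have "a \<in> pverts J \<and> b \<in> pverts J" if "(a, b) \<in> parcs J" for a b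
    using that by (cases a rule: vertex_cases; cases b rule: vertex_cases)
      (auto dest: G1.edge_subset_pverts G2.in_arcsD1 G2.in_arcsD2 G3.in_arcsD1 G3.in_arcsD2)
  then show "pair_wf_digraph J" by unfold_locales auto
qed

lemma vertex_on_edge: "u \<in> pverts G1 \<Longrightarrow> \<exists>e \<in> edges G1. u \<in> e"
  using ex_neighbour[of u] by (auto simp: edges_def)

lemma edges_G1_nonempty: "edges G1 \<noteq> {}"
  using nonempty(1) vertex_on_edge by blast

section \<open>Distances in the join\<close>

abbreviation "d \<equiv> graph_dist J"

text \<open>Adjacent vertices of \<open>G1\<close> lose their edge in the central graph but share
  the new vertex of that edge; distinct nonadjacent ones are joined directly.\<close>

lemma dist_UU:
  assumes "u \<in> pverts G1" "v \<in> pverts G1"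
  shows "d (Inl (Inl u)) (Inl (Inl v)) = (if u = v then 0 else if (u, v) \<in> parcs G1 then 2 else 1)"
proof (cases "(u, v) \<in> parcs G1")
  case True
  then have "{u, v} \<in> edges G1" "u \<noteq> v" by (auto simp: G1.edge_iff G1.no_loops')
  then show ?thesis using True by (subst J.graph_dist_two[of _ _ "Inl (Inr {u, v})"]) auto
next
  case False
  then show ?thesis using assms J.graph_dist_self J.graph_dist_arc by auto
qed

text \<open>This is where triangle-freeness enters: a vertex off \<open>e\<close> that is adjacent
  to both ends of \<open>e\<close> would form a triangle. The end found here is a common neighbour
  of \<open>u\<close> and the edge vertex in the join.\<close>

lemma endpoint_not_adjacent:
  assumes "e \<in> edges G1" "u \<notin> e"
  obtains v where "v \<in> e" "v \<noteq> u" "v \<in> pverts G1" "(u, v) \<notin> parcs G1" "(v, u) \<notin> parcs G1"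
proof -
  obtain v w where e: "e = {v, w}" "(v, w) \<in> parcs G1"
    using assms(1) G1.edge_obtain by metis
  have "(u, v) \<notin> parcs G1 \<or> (u, w) \<notin> parcs G1"
    using triangle_free e(2) unfolding triangle_free_def by blast
  then show thesis
    using e assms that G1.parcs_sym G1.in_arcsD1 G1.in_arcsD2 by (metis insertCI)
qed

lemma dist_UW:
  assumes "u \<in> pverts G1" "e \<in> edges G1"
  shows "d (Inl (Inl u)) (Inl (Inr e)) = (if u \<in> e then 1 else 2)"
    and "d (Inl (Inr e)) (Inl (Inl u)) = (if u \<in> e then 1 else 2)"
proof -
  have "d (Inl (Inl u)) (Inl (Inr e)) = 2 \<and> d (Inl (Inr e)) (Inl (Inl u)) = 2" if "u \<notin> e"
  proof -
    from endpoint_not_adjacent[OF assms(2) that] obtain v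
      where "v \<in> e" "v \<noteq> u" "v \<in> pverts G1" "(u, v) \<notin> parcs G1" "(v, u) \<notin> parcs G1" .
    then show ?thesis using assms that
      by (intro conjI J.graph_dist_two[of _ _ "Inl (Inl v)"]) auto
  qed
  then show "d (Inl (Inl u)) (Inl (Inr e)) = (if u \<in> e then 1 else 2)"
    and "d (Inl (Inr e)) (Inl (Inl u)) = (if u \<in> e then 1 else 2)"
    using assms J.graph_dist_arc by auto
qed

text \<open>Any vertex of \<open>G3\<close> is a common neighbour of two edge vertices.\<close>

lemma dist_WW:
  assumes "e \<in> edges G1" "f \<in> edges G1"
  shows "d (Inl (Inr e)) (Inl (Inr f)) = (if e = f then 0 else 2)"
proof -
  obtain y where "y \<in> pverts G3" using nonempty by blast
  then show ?thesis using assms J.graph_dist_self J.graph_dist_two[of _ _ "Inr (Inr y)"] by auto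
qed

lemma dist_UX:
  assumes "u \<in> pverts G1" "x \<in> pverts G2"
  shows "d (Inl (Inl u)) (Inr (Inl x)) = 1" "d (Inr (Inl x)) (Inl (Inl u)) = 1"
  using assms J.graph_dist_arc by auto

lemma dist_WY:
  assumes "e \<in> edges G1" "y \<in> pverts G3"
  shows "d (Inl (Inr e)) (Inr (Inr y)) = 1" "d (Inr (Inr y)) (Inl (Inr e)) = 1"
  using assms J.graph_dist_arc by auto

lemma dist_UY:
  assumes "u \<in> pverts G1" "y \<in> pverts G3"
  shows "d (Inl (Inl u)) (Inr (Inr y)) = 2" "d (Inr (Inr y)) (Inl (Inl u)) = 2"
proof -
  obtain e where "e \<in> edges G1" "u \<in> e" using vertex_on_edge[OF assms(1)] by blast
  then show "d (Inl (Inl u)) (Inr (Inr y)) = 2" "d (Inr (Inr y)) (Inl (Inl u)) = 2"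
    using assms J.graph_dist_two[of _ _ "Inl (Inr e)"] by auto
qed

lemma dist_WX:
  assumes "e \<in> edges G1" "x \<in> pverts G2"
  shows "d (Inl (Inr e)) (Inr (Inl x)) = 2" "d (Inr (Inl x)) (Inl (Inr e)) = 2"
proof -
  obtain u where "u \<in> e" "u \<in> pverts G1"
    using assms(1) G1.edge_subset_pverts G1.edge_obtain by (metis insertI1 subsetD)
  then show "d (Inl (Inr e)) (Inr (Inl x)) = 2" "d (Inr (Inl x)) (Inl (Inr e)) = 2"
    using assms J.graph_dist_two[of _ _ "Inl (Inl u)"] by auto
qed

text \<open>The neighbours of \<open>x\<close> lie in \<open>U\<close> and \<open>X\<close>, those
  of \<open>y\<close> in \<open>W\<close> and \<open>Y\<close>, so there is no common neighbour; a
  vertex of \<open>G1\<close> and an edge at it complete a walk with three arcs.\<close>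

lemma dist_XY:
  assumes "x \<in> pverts G2" "y \<in> pverts G3"
  shows "d (Inr (Inl x)) (Inr (Inr y)) = 3" "d (Inr (Inr y)) (Inr (Inl x)) = 3"
proof -
  obtain u where u: "u \<in> pverts G1" using nonempty by blast
  obtain e where e: "e \<in> edges G1" "u \<in> e" using vertex_on_edge[OF u] by blast
  have no: "(Inr (Inl x), w) \<in> parcs J \<Longrightarrow> (w, Inr (Inr y)) \<notin> parcs J"
    "(Inr (Inr y), w) \<in> parcs J \<Longrightarrow> (w, Inr (Inl x)) \<notin> parcs J" for w
    by (cases w rule: vertex_cases; simp)+
  show "d (Inr (Inl x)) (Inr (Inr y)) = 3"
    using assms u e no by (intro J.graph_dist_three[of _ _ "Inl (Inl u)" "Inl (Inr e)"]) auto
  show "d (Inr (Inr y)) (Inr (Inl x)) = 3"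
    using assms u e no by (intro J.graph_dist_three[of _ _ "Inl (Inr e)" "Inl (Inl u)"]) auto
qed

text \<open>A bound below 3 suffices: both eccentricities will be 3, so every entry of this block is
  0 whatever the exact distance. The same holds for \<open>dist_YY\<close>.\<close>

lemma dist_XX:
  assumes "x \<in> pverts G2" "x' \<in> pverts G2"
  shows "d (Inr (Inl x)) (Inr (Inl x')) \<in> {0, 1, 2}"
proof -
  obtain u where u: "u \<in> pverts G1" using nonempty by blast
  then show ?thesis
    using assms J.graph_dist_self[of "Inr (Inl x)"] J.graph_dist_arc[of "Inr (Inl x)" "Inr (Inl x')"]
      J.graph_dist_two[of "Inr (Inl x)" "Inr (Inl x')" "Inl (Inl u)"]
    by (cases "x = x'"; cases "(x, x') \<in> parcs G2") auto
qed

lemma dist_YY: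
  assumes "y \<in> pverts G3" "y' \<in> pverts G3"
  shows "d (Inr (Inr y)) (Inr (Inr y')) \<in> {0, 1, 2}"
proof -
  obtain e where e: "e \<in> edges G1" using edges_G1_nonempty by blast
  then show ?thesis
    using assms J.graph_dist_self[of "Inr (Inr y)"] J.graph_dist_arc[of "Inr (Inr y)" "Inr (Inr y')"]
      J.graph_dist_two[of "Inr (Inr y)" "Inr (Inr y')" "Inl (Inr e)"]
    by (cases "y = y'"; cases "(y, y') \<in> parcs G3") auto
qed

section \<open>Eccentricities and matrix entries\<close>

lemmas dist_simps = dist_UU dist_UW dist_WW dist_UX dist_WY dist_UY dist_WX dist_XY

lemma dist_Inl_le_2:
  assumes "Inl a \<in> pverts J" "b \<in> pverts J"
  shows "d (Inl a) b \<le> 2"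
  using assms by (cases a; cases b rule: vertex_cases) (force simp: dist_simps)+

lemma dist_le_3:
  assumes "a \<in> pverts J" "b \<in> pverts J"
  shows "d a b \<le> 3"
  using assms dist_XX dist_YY
  by (cases a rule: vertex_cases; cases b rule: vertex_cases) (force simp: dist_simps)+

text \<open>The maximum is attained on \<open>Y\<close> for vertices in \<open>U\<close> and
  \<open>X\<close>, and on \<open>X\<close> for vertices in \<open>W\<close> and
  \<open>Y\<close>.\<close>

lemma eccentricity_J:
  assumes "a \<in> pverts J"
  shows "eccentricity J a = (case a of Inl _ \<Rightarrow> 2 | Inr _ \<Rightarrow> 3)"
proof -
  obtain x y where xy: "x \<in> pverts G2" "y \<in> pverts G3" using nonempty by blast
  have fin: "finite (d a ` pverts J)" using finite_pverts_J by simp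
  show ?thesis
  proof (cases a rule: vertex_cases)
    case (1 u)
    then have "2 \<in> d a ` pverts J" using assms xy
      by (intro image_eqI[of _ _ "Inr (Inr y)"]) (auto simp: dist_simps)
    then show ?thesis using assms 1 fin dist_Inl_le_2 unfolding eccentricity_def
      by (auto intro!: Max_eqI)
  next
    case (2 e)
    then have "2 \<in> d a ` pverts J" using assms xy
      by (intro image_eqI[of _ _ "Inr (Inl x)"]) (auto simp: dist_simps)
    then show ?thesis using assms 2 fin dist_Inl_le_2 unfolding eccentricity_def
      by (auto intro!: Max_eqI)
  next
    case (3 x')
    then have "3 \<in> d a ` pverts J" using assms xy
      by (intro image_eqI[of _ _ "Inr (Inr y)"]) (auto simp: dist_simps)
    then show ?thesis using assms 3 fin dist_le_3 unfolding eccentricity_def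
      by (auto intro!: Max_eqI)
  next
    case (4 y')
    then have "3 \<in> d a ` pverts J" using assms xy
      by (intro image_eqI[of _ _ "Inr (Inl x)"]) (auto simp: dist_simps)
    then show ?thesis using assms 4 fin dist_le_3 unfolding eccentricity_def
      by (auto intro!: Max_eqI)
  qed
qed

text \<open>If one vertex lies in \<open>U\<close> or \<open>W\<close>, the minimum is 2 and exactly
  the distances equal to 2 survive; on \<open>X\<close> and \<open>Y\<close> it is 3, and only the
  pairs between \<open>X\<close> and \<open>Y\<close> survive. The constant weight 2 on
  \<open>UW\<close> and \<open>WW\<close> is cancelled by the local part at incident pairs and on
  the diagonal.\<close>

lemma eccentricity_entry:
  assumes "a \<in> pverts J" "b \<in> pverts J"
  shows "(if d a b = min (eccentricity J a) (eccentricity J b) then real_of_ereal (d a b) else 0) =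
    local_part (parcs G1) a b + cell_weight (cell a) (cell b)"
proof -
  have real [simp]: "real_of_ereal 2 = 2" "real_of_ereal 3 = 3"
    by (metis numeral_eq_ereal real_of_ereal.simps(1))+
  have [simp]: "(u, u) \<notin> parcs G1" for u using G1.no_loops' by blast
  show ?thesis
    using assms dist_XX dist_YY
    by (cases a rule: vertex_cases; cases b rule: vertex_cases)
      (force simp: dist_simps eccentricity_J cell_weight_def min_def)+
qed

lemma eccentricity_matrix_J:
  assumes "set vs = pverts J"
  shows "eccentricity_matrix J vs =
    list_mat (\<lambda>a b. local_part (parcs G1) a b + cell_weight (cell a) (cell b)) vs vs"
proof (rule eq_matI, goal_cases)
  case (1 i j)
  then have "vs ! i \<in> pverts J" "vs ! j \<in> pverts J"
    using nth_mem[of i vs] nth_mem[of j vs] assms by simp_all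
  from eccentricity_entry[OF this] 1 show ?case
    by (simp add: eccentricity_matrix_def)
qed (simp_all add: eccentricity_matrix_def)

section \<open>Sums over cells and the incidence matrix\<close>

definition cell_size :: "nat \<Rightarrow> real" where
  "cell_size k = real ([card (pverts G1), card (edges G1), card (pverts G2), card (pverts G3)] ! k)"

definition quotient_local :: "nat \<Rightarrow> nat \<Rightarrow> real" where
  "quotient_local i j =
    [[2 * real r, -2 * real r, 0, 0], [-4, -2, 0, 0], [0, 0, 0, 0], [0, 0, 0, 0]] ! i ! j"

text \<open>This is \<open>E\<^sub>0 P = P D\<close> entrywise: a vertex of \<open>G1\<close> has
  \<open>r\<close> neighbours and lies on \<open>r\<close> edges, and an edge has two ends.\<close>

lemma local_part_row_sum:
  assumes "a \<in> pverts J" "k < 4"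
  shows "(\<Sum>b\<in>pverts J. local_part (parcs G1) a b * (if cell b = k then 1 else 0)) =
    quotient_local (cell a) k"
proof -
  have k: "k = 0 \<or> k = 1 \<or> k = 2 \<or> k = 3" using assms(2) by auto
  note fin = finite_edges_G1
  show ?thesis
  proof (cases a rule: vertex_cases)
    case (1 u)
    then have u: "u \<in> pverts G1" using assms by simp
    have "{v \<in> pverts G1. (u, v) \<in> parcs G1} = {v. (u, v) \<in> parcs G1}"
      using G1.in_arcsD2 by auto
    then have "(\<Sum>v\<in>pverts G1. if (u, v) \<in> parcs G1 then 2 else 0 :: real) = 2 * real r"
      using G1.card_neighbours[OF regular u] by (simp add: sum.If_cases Int_def)
    moreover have "(\<Sum>e\<in>edges G1. if u \<in> e then -2 else 0 :: real) = -2 * real r"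
      using G1.card_incident_edges[OF regular u] fin by (simp add: sum.If_cases Int_def)
    ultimately show ?thesis
      using k unfolding pverts_J 1
      by (subst sum_join) (auto simp: fin quotient_local_def numeral_eq_Suc)
  next
    case (2 e)
    then have e: "e \<in> edges G1" using assms by simp
    have "{u \<in> pverts G1. u \<in> e} = e" using G1.edge_subset_pverts[OF e] by auto
    then have "(\<Sum>u\<in>pverts G1. if u \<in> e then -2 else 0 :: real) = -4"
      using G1.card_edge[OF e] by (simp add: sum.If_cases Int_def)
    moreover have "(\<Sum>f\<in>edges G1. if e = f then -2 else 0 :: real) = -2"
      using e fin by simp
    ultimately show ?thesis
      using k unfolding pverts_J 2
      by (subst sum_join) (auto simp: fin quotient_local_def numeral_eq_Suc)
  next
    case (3 x)
    show ?thesis using k unfolding pverts_J 3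
      by (subst sum_join) (auto simp: fin quotient_local_def numeral_eq_Suc)
  next
    case (4 y)
    show ?thesis using k unfolding pverts_J 4
      by (subst sum_join) (auto simp: fin quotient_local_def numeral_eq_Suc)
  qed
qed

text \<open>These are the entries of \<open>L P\<close>: each weight is counted once per vertex of
  the cell.\<close>

lemma cell_weight_column_sum:
  assumes "k < 4"
  shows "(\<Sum>b\<in>pverts J. cell_weight i (cell b) * (if cell b = k then 1 else 0)) =
    cell_weight i k * cell_size k"
proof -
  have k: "k = 0 \<or> k = 1 \<or> k = 2 \<or> k = 3" using assms by auto
  then show ?thesis unfolding pverts_J
    by (subst sum_join) (auto simp: finite_edges_G1 cell_size_def)
qed

text \<open>The identity \<open>M M\<^sup>T = A + r I\<close>: an entry counts the edges that
  contain both vertices.\<close>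

lemma incidence_gram:
  assumes "u \<in> pverts G1" "v \<in> pverts G1"
  shows "(\<Sum>e\<in>edges G1. (if u \<in> e then 1 else 0) * (if v \<in> e then 1 else 0 :: complex)) =
    (if u = v then of_nat r else if (u, v) \<in> parcs G1 then 1 else 0)"
proof -
  have "(\<Sum>e\<in>edges G1. (if u \<in> e then 1 else 0) * (if v \<in> e then 1 else 0 :: complex)) =
      (\<Sum>e\<in>edges G1. if u \<in> e \<and> v \<in> e then 1 else 0)"
    by (intro sum.cong) auto
  also have "\<dots> = of_nat (card {e \<in> edges G1. u \<in> e \<and> v \<in> e})"
    using finite_edges_G1 by (simp add: sum.If_cases Int_def)
  also have "\<dots> = (if u = v then of_nat r else if (u, v) \<in> parcs G1 then 1 else 0)"
    using G1.card_incident_edges[OF regular assms(1)] G1.edges_containing_pair[of u v] by auto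
  finally show ?thesis .
qed

end

section \<open>Characteristic polynomials\<close>

lemma list_mat_zero_const:
  "(\<And>x y. x \<in> set xs \<Longrightarrow> y \<in> set ys \<Longrightarrow> f x y = 0) \<Longrightarrow> list_mat f xs ys = 0\<^sub>m (length xs) (length ys)"
  by (rule eq_matI) auto

lemma det_list_mat_two:
  fixes f :: "nat \<Rightarrow> nat \<Rightarrow> 'a :: idom"
  shows "det (list_mat f [i, j] [i, j]) = f i i * f j j - f i j * f j i"
proof -
  have c: "list_mat g [a] [b] \<in> carrier_mat 1 1" for g :: "nat \<Rightarrow> nat \<Rightarrow> 'a" and a b
    using list_mat_carrier[of g "[a]" "[b]"] by simp
  have "det (list_mat f ([i] @ [j]) ([i] @ [j])) =
      det (list_mat f [i] [i] * list_mat f [j] [j] - list_mat f [i] [j] * list_mat f [j] [i])"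
    unfolding list_mat_append
    \<comment> \<open>The remaining side condition is that the two lower blocks commute, which holds
      for matrices of size 1.\<close>
    by (rule det_four_block_mat[OF c c c c]) (rule eq_matI; simp add: scalar_prod_def)
  also have "\<dots> = f i i * f j j - f i j * f j i"
    by (subst det_single) (auto simp: scalar_prod_def intro!: minus_carrier_mat mult_carrier_mat[of _ 1 1] c)
  finally show ?thesis by simp
qed

context central_join
begin

text \<open>The cells \<open>X\<close> and \<open>Y\<close> contribute \<open>t\<^sup>2\<close>. The
  quadratic is the factor that the adjacency eigenvalue \<open>r\<close> contributes in
  \<open>det_local_part\<close>, which makes the later cancellation possible.\<close>

lemma det_quotient_local:
  "det (list_mat (\<lambda>i j. (if i = j then t else 0) - complex_of_real (quotient_local i j)) [0..<4] [0..<4]) =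
    t\<^sup>2 * (t\<^sup>2 - 2 * (of_nat r - 1) * t - 12 * of_nat r)"
proof -
  let ?Y = "\<lambda>i j. (if i = j then t else 0) - complex_of_real (quotient_local i j)"
  have "[0..<4] = [0, 1] @ [2, 3::nat]" by (simp add: upt_rec)
  then have "det (list_mat ?Y [0..<4] [0..<4]) = det (list_mat ?Y ([0, 1] @ [2, 3]) ([0, 1] @ [2, 3]))"
    by simp
  also have "\<dots> = det (list_mat ?Y [0, 1] [0, 1]) * det (list_mat ?Y [2, 3] [2, 3])"
    unfolding list_mat_append
    by (rule det_four_block_mat_lower_left_zero[OF list_mat_carrier list_mat_carrier _ list_mat_carrier],
        rule list_mat_zero_const) (auto simp: quotient_local_def)
  also have "det (list_mat ?Y [0, 1] [0, 1]) =
      (t - 2 * of_nat r) * (t + 2) - 2 * of_nat r * 4"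
    unfolding det_list_mat_two by (simp add: quotient_local_def)
  also have "det (list_mat ?Y [2, 3] [2, 3]) = t * t"
    unfolding det_list_mat_two by (simp add: quotient_local_def)
  also have "((t - 2 * of_nat r) * (t + 2) - 2 * of_nat r * 4) * (t * t) =
      t\<^sup>2 * (t\<^sup>2 - 2 * (of_nat r - 1) * t - 12 * of_nat r)"
    by (simp add: power2_eq_square algebra_simps)
  finally show ?thesis .
qed

definition quotient_mat :: "complex mat" where
  "quotient_mat = list_mat (\<lambda>i j. complex_of_real (quotient_local i j + cell_weight i j * cell_size j)) [0..<4] [0..<4]"

text \<open>An instance of \<open>det_intertwined_update\<close> with
  \<open>X = t I - E\<^sub>0\<close> and \<open>Y = t I - D\<close>: then \<open>X - P L\<close> is
  \<open>t I\<close> minus the eccentricity matrix, and \<open>Y - L P\<close> is \<open>t I\<close>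
  minus \<open>quotient_mat\<close>.\<close>

lemma det_update:
  assumes L: "distinct L" "set L = pverts J"
  shows "poly (char_poly (map_mat complex_of_real (eccentricity_matrix J L))) t *
      (t\<^sup>2 * (t\<^sup>2 - 2 * (of_nat r - 1) * t - 12 * of_nat r)) =
    det (list_mat (\<lambda>a b. (if a = b then t else 0) - complex_of_real (local_part (parcs G1) a b)) L L) *
      poly (char_poly quotient_mat) t"
proof -
  let ?N = "[0..<4] :: nat list"
  let ?x = "\<lambda>a b. (if a = b then t else 0) - complex_of_real (local_part (parcs G1) a b)"
  let ?p = "\<lambda>a k. if cell a = k then 1 else 0 :: complex"
  let ?l = "\<lambda>k b. complex_of_real (cell_weight k (cell b))"
  let ?y = "\<lambda>i j. (if i = j then t else 0) - complex_of_real (quotient_local i j)"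
  have cell: "cell a < 4" for a :: "('a + 'a set) + ('b + 'c)" by (cases a rule: vertex_cases) auto
  have fin: "finite (pverts J)" by (rule finite_pverts_J)
  have "list_mat ?x L L * list_mat ?p L ?N = list_mat ?p L ?N * list_mat ?y ?N ?N"
    unfolding list_mat_mult[OF L(1)] list_mat_mult[OF distinct_upt]
  proof (rule list_mat_cong)
    fix a k assume "a \<in> set L" "k \<in> set ?N"
    then have a: "a \<in> pverts J" and k: "k < 4" using L by auto
    have "(\<Sum>b\<in>set L. ?x a b * ?p b k) =
        (\<Sum>b\<in>pverts J. if a = b then t * ?p b k else 0) -
        complex_of_real (\<Sum>b\<in>pverts J. local_part (parcs G1) a b * (if cell b = k then 1 else 0))"
      unfolding L(2) of_real_sum sum_subtractf[symmetric]
      by (intro sum.cong) (auto simp: algebra_simps)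
    also have "\<dots> = ?y (cell a) k"
      unfolding local_part_row_sum[OF a k] using a fin by simp
    also have "\<dots> = (\<Sum>j\<in>set ?N. ?p a j * ?y j k)"
      using cell[of a] by (simp add: if_distrib[of "\<lambda>x. x * _"] cong: if_cong)
    finally show "(\<Sum>b\<in>set L. ?x a b * ?p b k) = (\<Sum>j\<in>set ?N. ?p a j * ?y j k)" .
  qed
  then have "det (list_mat ?x L L - list_mat ?p L ?N * list_mat ?l ?N L) * det (list_mat ?y ?N ?N) =
      det (list_mat ?x L L) * det (list_mat ?y ?N ?N - list_mat ?l ?N L * list_mat ?p L ?N)"
    by (intro det_intertwined_update[of _ "length L" _ 4])
       (use list_mat_carrier[of _ ?N] list_mat_carrier[of _ L ?N] in auto)
  also have "list_mat ?x L L - list_mat ?p L ?N * list_mat ?l ?N L =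
      list_mat (\<lambda>a b. (if a = b then t else 0) -
        complex_of_real (local_part (parcs G1) a b + cell_weight (cell a) (cell b))) L L"
    unfolding list_mat_mult[OF distinct_upt] list_mat_minus
    using cell by (intro list_mat_cong) (simp add: if_distrib[of "\<lambda>x. x * _"] cong: if_cong)
  also have "det \<dots> = poly (char_poly (map_mat complex_of_real (eccentricity_matrix J L))) t"
    unfolding eccentricity_matrix_J[OF L(2)] map_mat_list_mat poly_char_poly_list_mat[OF L(1)] ..
  also have "list_mat ?y ?N ?N - list_mat ?l ?N L * list_mat ?p L ?N =
      list_mat (\<lambda>i j. (if i = j then t else 0) -
        complex_of_real (quotient_local i j + cell_weight i j * cell_size j)) ?N ?N"
    unfolding list_mat_mult[OF L(1)] list_mat_minus
  proof (rule list_mat_cong)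
    fix i j assume "i \<in> set ?N" "j \<in> set ?N"
    then have j: "j < 4" by simp
    have "(\<Sum>b\<in>set L. ?l i b * ?p b j) =
        complex_of_real (\<Sum>b\<in>pverts J. cell_weight i (cell b) * (if cell b = j then 1 else 0))"
      unfolding L(2) of_real_sum by (intro sum.cong) auto
    then show "?y i j - (\<Sum>b\<in>set L. ?l i b * ?p b j) = (if i = j then t else 0) -
        complex_of_real (quotient_local i j + cell_weight i j * cell_size j)"
      unfolding cell_weight_column_sum[OF j] by simp
  qed
  also have "det \<dots> = poly (char_poly quotient_mat) t"
    unfolding quotient_mat_def poly_char_poly_list_mat[OF distinct_upt] ..
  finally show ?thesis unfolding det_quotient_local .
qed

text \<open>With the vertices listed as \<open>U\<close>, \<open>W\<close>, then the rest, the rest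
  splits off a power of \<open>t\<close>. In the remaining block matrix the \<open>WW\<close> block
  is the scalar matrix \<open>(t + 2) I\<close>, so \<open>det_four_block_scalar\<close> reduces it
  to the size of \<open>A\<close>; its factor \<open>(t + 2) ^ card (pverts G1)\<close> stays on the
  left to avoid dividing.\<close>

lemma det_local_part:
  fixes ws :: "('b + 'c) list"
  assumes us: "enumerates us G1" and es: "distinct es" "set es = edges G1"
    and ws: "distinct ws"
    and chi: "char_poly (map_mat complex_of_real (adjacency_matrix G1 us)) = (\<Prod>i\<in>I. [:- complex_of_real (lam i), 1:])"
  shows "det (list_mat (\<lambda>a b. (if a = b then t else 0) - complex_of_real (local_part (parcs G1) a b))
      (map Inl (map Inl us @ map Inr es) @ map Inr ws) (map Inl (map Inl us @ map Inr es) @ map Inr ws)) *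
      (t + 2) ^ card (pverts G1) =
    t ^ length ws * (t + 2) ^ card (edges G1) *
      (\<Prod>i\<in>I. t\<^sup>2 + 2 * t - 4 * of_nat r - (2 * t + 8) * of_real (lam i))"
proof -
  let ?x = "\<lambda>a b :: ('a + 'a set) + ('b + 'c). (if a = b then t else 0) - complex_of_real (local_part (parcs G1) a b)"
  let ?U = "map Inl us @ map Inr es :: ('a + 'a set) list"
  let ?g = "\<lambda>u v. (if u = v then t else 0) - (if (u, v) \<in> parcs G1 then 2 else 0 :: complex)"
  let ?m = "\<lambda>u e. if u \<in> e then 2 else 0 :: complex"
  have us': "distinct us" "set us = pverts G1" using us by (auto simp: enumerates_def)
  have len: "length us = card (pverts G1)" "length es = card (edges G1)"
    using us' es by (metis distinct_card)+
  have W: "list_mat ?x (map Inr ws) (map Inr ws) = list_mat (\<lambda>a b. if a = b then t else 0) ws ws"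
  proof -
    have "local_part (parcs G1) (Inr a) (Inr b) = 0" for a b :: "'b + 'c"
      by (cases a; cases b) auto
    then show ?thesis unfolding list_mat_map by (intro list_mat_cong) auto
  qed
  have Z: "list_mat ?x (map Inr ws) (map Inl ?U) =
      0\<^sub>m (length (map Inr ws :: (('a + 'a set) + ('b + 'c)) list))
        (length (map Inl ?U :: (('a + 'a set) + ('b + 'c)) list))"
  proof -
    have "local_part (parcs G1) (Inr a) (Inl b) = 0" for a :: "'b + 'c" and b
      by (cases a; cases b) auto
    then show ?thesis by (intro list_mat_zero_const) (simp only: set_map, fastforce)
  qed
  have "det (list_mat ?x (map Inl ?U @ map Inr ws) (map Inl ?U @ map Inr ws)) =
      det (list_mat ?x (map Inl ?U) (map Inl ?U)) * det (list_mat ?x (map Inr ws) (map Inr ws))"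
    unfolding list_mat_append
    by (rule det_four_block_mat_lower_left_zero[OF list_mat_carrier list_mat_carrier Z list_mat_carrier])
  also have "det (list_mat ?x (map Inr ws) (map Inr ws)) = t ^ length ws"
    unfolding W by (rule det_list_mat_scalar[OF ws])
  also have "list_mat ?x (map Inl ?U) (map Inl ?U) =
      four_block_mat (list_mat ?g us us) (list_mat ?m us es) (list_mat (\<lambda>e u. ?m u e) es us)
        ((t + 2) \<cdot>\<^sub>m 1\<^sub>m (length es))"
    unfolding map_append list_mat_append one_mat_list_mat[OF es(1)] list_mat_smult
    unfolding map_map list_mat_map
    by (intro cong_four_block_mat list_mat_cong) auto
  finally have 1: "det (list_mat ?x (map Inl ?U @ map Inr ws) (map Inl ?U @ map Inr ws)) =
    det (four_block_mat (list_mat ?g us us) (list_mat ?m us es) (list_mat (\<lambda>e u. ?m u e) es us)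
        ((t + 2) \<cdot>\<^sub>m 1\<^sub>m (length es))) * t ^ length ws" .
  have 2: "det (four_block_mat (list_mat ?g us us) (list_mat ?m us es) (list_mat (\<lambda>e u. ?m u e) es us)
        ((t + 2) \<cdot>\<^sub>m 1\<^sub>m (length es))) * (t + 2) ^ length us =
      det ((t + 2) \<cdot>\<^sub>m list_mat ?g us us - list_mat ?m us es * list_mat (\<lambda>e u. ?m u e) es us) *
        (t + 2) ^ length es"
    by (rule det_four_block_scalar) auto
  have adj: "map_mat complex_of_real (adjacency_matrix G1 us) =
      list_mat (\<lambda>u v. if (u, v) \<in> parcs G1 then 1 else 0) us us"
    unfolding adjacency_matrix_def by (rule eq_matI) auto
  \<comment> \<open>The Schur complement is \<open>(t + 2) (t I - 2 A) - 4 M M\<^sup>T\<close>;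
    substituting \<open>M M\<^sup>T = A + r I\<close> leaves a linear expression in
    \<open>A\<close>.\<close>
  have 3: "(t + 2) \<cdot>\<^sub>m list_mat ?g us us - list_mat ?m us es * list_mat (\<lambda>e u. ?m u e) es us =
      (t\<^sup>2 + 2 * t - 4 * of_nat r) \<cdot>\<^sub>m 1\<^sub>m (length us) -
      (2 * t + 8) \<cdot>\<^sub>m map_mat complex_of_real (adjacency_matrix G1 us)"
    unfolding adj list_mat_mult[OF es(1)] one_mat_list_mat[OF us'(1)] list_mat_smult list_mat_minus
  proof (rule list_mat_cong)
    fix u v assume "u \<in> set us" "v \<in> set us"
    then have uv: "u \<in> pverts G1" "v \<in> pverts G1" using us' by auto
    have "(\<Sum>e\<in>set es. ?m u e * ?m v e) =
        4 * (\<Sum>e\<in>edges G1. (if u \<in> e then 1 else 0) * (if v \<in> e then 1 else 0 :: complex))"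
      unfolding es(2) sum_distrib_left by (intro sum.cong) auto
    also note incidence_gram[OF uv]
    finally have m: "(\<Sum>e\<in>set es. ?m u e * ?m v e) =
      4 * (if u = v then of_nat r else if (u, v) \<in> parcs G1 then 1 else 0)" .
    show "(t + 2) * ?g u v - (\<Sum>e\<in>set es. ?m u e * ?m v e) =
        (t\<^sup>2 + 2 * t - 4 * of_nat r) * (if u = v then 1 else 0) -
        (2 * t + 8) * (if (u, v) \<in> parcs G1 then 1 else 0)"
      unfolding m using G1.no_loops'[of u v] by (auto simp: power2_eq_square algebra_simps)
  qed
  have 4: "det ((t\<^sup>2 + 2 * t - 4 * of_nat r) \<cdot>\<^sub>m 1\<^sub>m (length us) -
      (2 * t + 8) \<cdot>\<^sub>m map_mat complex_of_real (adjacency_matrix G1 us)) =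
      (\<Prod>i\<in>I. t\<^sup>2 + 2 * t - 4 * of_nat r - (2 * t + 8) * of_real (lam i))"
    by (rule det_smult_minus_smult[OF _ chi]) (simp add: adj)
  show ?thesis
    using 2 unfolding 1 3 4 unfolding len by (simp add: mult_ac)
qed

end

section \<open>Roots of products and the adjacency spectrum of a regular graph\<close>

lemma sum_nth_distinct:
  "distinct xs \<Longrightarrow> (\<Sum>i<length xs. f (xs ! i)) = (\<Sum>x\<in>set xs. f x)"
  by (simp add: sum.distinct_set_conv_list sum_list_sum_nth atLeast0LessThan)

lemma proots_prod_linear:
  "proots (\<Prod>j\<in>A. [:- f j, 1:]) = image_mset f (mset_set A)"
  by (subst proots_prod) (simp_all add: sum_unfold_sum_mset)

lemma char_poly_nonzero:
  fixes A :: "'a :: comm_ring_1 mat"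
  assumes "A \<in> carrier_mat n n"
  shows "char_poly A \<noteq> 0"
  using degree_monic_char_poly[OF assms] by force

lemma char_poly_adjacency:
  assumes "adjacency_eigenvalues G lam" "enumerates us G"
  shows "char_poly (map_mat complex_of_real (adjacency_matrix G us)) =
    (\<Prod>j\<in>{1..card (pverts G)}. [:- complex_of_real (lam j), 1:])"
proof (rule char_poly_eq_prod_roots)
  show "map_mat complex_of_real (adjacency_matrix G us) \<in> carrier_mat (length us) (length us)"
    by (simp add: adjacency_matrix_def)
  show "proots (char_poly (map_mat complex_of_real (adjacency_matrix G us))) =
      {#complex_of_real (lam j). j \<in># mset_set {1..card (pverts G)}#}"
    using assms by (auto simp: adjacency_eigenvalues_def eigenvalues_def)
qed

lemma (in pair_graph) sum_neighbours:
  assumes "regular G r" "u \<in> pverts G"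
  shows "(\<Sum>v\<in>pverts G. if (u, v) \<in> parcs G then 1 else 0) = (of_nat r :: 'b :: semiring_1)"
proof -
  have "{v \<in> pverts G. (u, v) \<in> parcs G} = {v. (u, v) \<in> parcs G}"
    using in_arcsD2 by auto
  then show ?thesis
    using card_neighbours[OF assms] by (simp add: sum.If_cases Int_def)
qed

text \<open>All row sums equal \<open>r\<close>, so \<open>r\<close> is an eigenvalue and no
  eigenvalue exceeds it in modulus. The first claim identifies the trivial factor to be cancelled;
  the second keeps the radicand in (1) nonnegative.\<close>

lemma (in pair_graph) regular_adjacency_eigenvalues:
  assumes reg: "regular G r" and lam: "adjacency_eigenvalues G lam" and ne: "pverts G \<noteq> {}"
  shows "lam 1 = real r" and "\<And>j. j \<in> {1..card (pverts G)} \<Longrightarrow> - real r \<le> lam j"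
proof -
  obtain us where us: "distinct us" "set us = pverts G"
    using finite_distinct_list[of "pverts G"] by auto
  then have enum: "enumerates us G" by (simp add: enumerates_def)
  have len: "length us = card (pverts G)" using us distinct_card by metis
  define A where "A = map_mat complex_of_real (adjacency_matrix G us)"
  have A: "A \<in> carrier_mat (length us) (length us)" by (simp add: A_def adjacency_matrix_def)
  have entry: "A $$ (i, j) = (if (us ! i, us ! j) \<in> parcs G then 1 else 0)"
    if "i < length us" "j < length us" for i j
    using that by (simp add: A_def adjacency_matrix_def)
  have us_nth: "us ! i \<in> pverts G" if "i < length us" for i using that us by auto
  have ev_iff: "eigenvalue A z \<longleftrightarrow> (\<exists>j\<in>{1..card (pverts G)}. z = complex_of_real (lam j))" for z
    unfolding eigenvalue_root_char_poly[OF A] char_poly_adjacency[OF lam enum, folded A_def]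
    by (auto simp: poly_prod)
  have bound: "\<bar>lam j\<bar> \<le> real r" if "j \<in> {1..card (pverts G)}" for j
  proof -
    have "cmod (complex_of_real (lam j)) \<le> real r"
    proof (rule cmod_eigenvalue_le_row_sum[OF A])
      show "eigenvalue A (complex_of_real (lam j))" using that ev_iff by blast
      fix i assume i: "i < length us"
      have "(\<Sum>j<length us. cmod (A $$ (i, j))) =
          (\<Sum>j<length us. if (us ! i, us ! j) \<in> parcs G then 1 else 0)"
        using i by (intro sum.cong) (auto simp: entry)
      also have "\<dots> = real r"
        using sum_nth_distinct[OF us(1), of "\<lambda>v. if (us ! i, v) \<in> parcs G then 1 else 0 :: real"]
          sum_neighbours[OF reg us_nth[OF i], where 'b = real] by (simp add: us(2))
      finally show "(\<Sum>j<length us. cmod (A $$ (i, j))) \<le> real r" by simp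
    qed
    then show ?thesis by simp
  qed
  show "- real r \<le> lam j" if "j \<in> {1..card (pverts G)}" for j
    using bound[OF that] by linarith
  have "length us > 0" using ne us by auto
  have "eigenvalue A (of_nat r)"
  proof (rule eigenvalue_constant_row_sum[OF A \<open>length us > 0\<close>])
    fix i assume i: "i < length us"
    have "(\<Sum>j<length us. A $$ (i, j)) =
        (\<Sum>j<length us. if (us ! i, us ! j) \<in> parcs G then 1 else 0)"
      using i by (intro sum.cong) (auto simp: entry)
    also have "\<dots> = of_nat r"
      using sum_nth_distinct[OF us(1), of "\<lambda>v. if (us ! i, v) \<in> parcs G then 1 else 0 :: complex"]
        sum_neighbours[OF reg us_nth[OF i], where 'b = complex] by (simp add: us(2))
    finally show "(\<Sum>j<length us. A $$ (i, j)) = of_nat r" .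
  qed
  then obtain j where j: "j \<in> {1..card (pverts G)}" "of_nat r = complex_of_real (lam j)"
    using ev_iff by blast
  from j(2) have "lam j = real r" by (metis of_real_eq_iff of_real_of_nat_eq)
  \<comment> \<open>The decreasing order moves the eigenvalue \<open>r\<close>, found at some index
    \<open>j\<close>, to index 1.\<close>
  moreover have "lam j \<le> lam 1"
    using lam j(1) unfolding adjacency_eigenvalues_def monotone_on_def by auto
  moreover have "\<bar>lam 1\<bar> \<le> real r" using bound[of 1] j(1) by auto
  ultimately show "lam 1 = real r" by linarith
qed

section \<open>Assembling the spectrum of the join\<close>

context central_join
begin

lemma quotient_mat_eq:
  "quotient_mat = map_mat complex_of_real (mat_of_rows_list 4
    [[2 * real r, 2 * (real (card (edges G1)) - real r), 0, 2 * real (card (pverts G3))],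
     [2 * (real (card (pverts G1)) - 2), 2 * (real (card (edges G1)) - 1), 2 * real (card (pverts G2)), 0],
     [0, 2 * real (card (edges G1)), 0, 3 * real (card (pverts G3))],
     [2 * real (card (pverts G1)), 0, 3 * real (card (pverts G2)), 0]])" (is "_ = ?M")
proof (rule eq_matI)
  fix i j assume "i < dim_row ?M" "j < dim_col ?M"
  then have "i < 4" "j < 4" by (auto simp: mat_of_rows_list_def)
  then have ij: "i \<in> {0, 1, 2, 3}" "j \<in> {0, 1, 2, 3}" by auto
  have "quotient_mat $$ (i, j) =
      complex_of_real (quotient_local i j + cell_weight i j * cell_size j)"
    unfolding quotient_mat_def using \<open>i < 4\<close> \<open>j < 4\<close> by (subst list_mat_index) simp_all
  also have "\<dots> = ?M $$ (i, j)"
    using ij by (auto simp: mat_of_rows_list_def quotient_local_def cell_weight_def cell_size_def)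
  finally show "quotient_mat $$ (i, j) = ?M $$ (i, j)" .
qed (simp_all add: quotient_mat_def mat_of_rows_list_def)

definition root_plus :: "real \<Rightarrow> complex" where
  "root_plus l = complex_of_real ((-1 + l) + sqrt ((1 + l)\<^sup>2 + 4 * (l + real r)))"

definition root_minus :: "real \<Rightarrow> complex" where
  "root_minus l = complex_of_real ((-1 + l) - sqrt ((1 + l)\<^sup>2 + 4 * (l + real r)))"

text \<open>Completing the square: the product is \<open>(t + 1 - l)\<^sup>2\<close> minus the
  radicand. Since \<open>- real r \<le> l\<close>, the radicand is nonnegative and the real square
  root squares back to it.\<close>

lemma root_plus_minus:
  assumes "- real r \<le> l"
  shows "(t - root_plus l) * (t - root_minus l) =
    t\<^sup>2 + 2 * t - 4 * of_nat r - (2 * t + 8) * complex_of_real l"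
proof -
  define s where "s = sqrt ((1 + l)\<^sup>2 + 4 * (l + real r))"
  have "s * s = (1 + l)\<^sup>2 + 4 * (l + real r)" unfolding s_def using assms by simp
  then have "complex_of_real s * complex_of_real s =
      complex_of_real ((1 + l)\<^sup>2 + 4 * (l + real r))"
    by (simp only: of_real_mult[symmetric])
  then have s: "complex_of_real s * complex_of_real s =
      (1 + complex_of_real l)\<^sup>2 + 4 * (complex_of_real l + of_nat r)" by simp
  have "(t - root_plus l) * (t - root_minus l) =
      (t + 1 - complex_of_real l)\<^sup>2 - complex_of_real s * complex_of_real s"
    unfolding root_plus_def root_minus_def s_def[symmetric]
    by (simp add: power2_eq_square algebra_simps)
  then show ?thesis unfolding s by (simp add: power2_eq_square algebra_simps)
qed

text \<open>\<open>det_update\<close> and \<open>det_local_part\<close> are combined at each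
  \<open>t\<close>; both sides then carry the characteristic polynomial of \<open>D\<close>, which
  is cancelled.\<close>

lemma char_poly_eccentricity_matrix:
  assumes lam: "adjacency_eigenvalues G1 lam" and vs: "enumerates vs J"
  shows "char_poly (map_mat complex_of_real (eccentricity_matrix J vs)) * [:2, 1:] ^ card (pverts G1) =
    [:0, 1:] ^ (card (pverts G2) + card (pverts G3) - 2) * [:2, 1:] ^ card (edges G1) *
    (\<Prod>j\<in>{2..card (pverts G1)}. [:- root_plus (lam j), 1:] * [:- root_minus (lam j), 1:]) *
    char_poly quotient_mat"
    (is "?chi * ?s ^ ?p1 = [:0, 1:] ^ (?p2 + ?p3 - 2) * _ * ?f * _")
proof -
  note spec = G1.regular_adjacency_eigenvalues[OF regular lam nonempty(1)]
  have p1: "1 \<le> ?p1" "1 \<le> ?p2" "1 \<le> ?p3"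
    using nonempty by (simp_all add: Suc_le_eq card_gt_0_iff)
  obtain us where us: "distinct us" "set us = pverts G1"
    using finite_distinct_list[of "pverts G1"] by auto
  then have enum: "enumerates us G1" by (simp add: enumerates_def)
  obtain es where es: "distinct es" "set es = edges G1"
    using finite_distinct_list[OF finite_edges_G1] by auto
  obtain ws where ws: "distinct ws" "set ws = pverts G2 <+> pverts G3"
    using finite_distinct_list[of "pverts G2 <+> pverts G3"] by auto
  have len: "length ws = ?p2 + ?p3"
    using ws by (metis distinct_card card_Plus G2.pair_finite_verts G3.pair_finite_verts)
  define L where "L = map Inl (map Inl us @ map Inr es) @ map Inr ws"
  have L: "distinct L" "set L = pverts J"
    using us es ws by (auto simp: L_def pverts_J distinct_map inj_on_def)
  have "mset vs = mset L"
    using vs L set_eq_iff_mset_eq_distinct[of vs L] by (auto simp: enumerates_def)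
  let ?q = "\<lambda>t. t\<^sup>2 * (t\<^sup>2 - 2 * (of_nat r - 1) * t - 12 * of_nat r) :: complex"
  \<comment> \<open>\<open>?Q\<close> is the characteristic polynomial of \<open>D\<close>, with
    coefficients listed from the constant term upwards.\<close>
  let ?Q = "[:0, 1:]\<^sup>2 * [:- 12 * of_nat r, - 2 * (of_nat r - 1), 1:] :: complex poly"
  have Q: "poly ?Q t = ?q t" for t
    by (simp add: power2_eq_square algebra_simps)
  have chi: "poly ?chi t = poly (char_poly (map_mat complex_of_real (eccentricity_matrix J L))) t" for t
  proof -
    have vs': "distinct vs" "set vs = pverts J" using vs by (auto simp: enumerates_def)
    show ?thesis
      unfolding eccentricity_matrix_J[OF vs'(2)] eccentricity_matrix_J[OF L(2)] map_mat_list_mat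
        poly_char_poly_list_mat[OF vs'(1)] poly_char_poly_list_mat[OF L(1)]
      by (rule det_list_mat_perm) fact
  qed
  \<comment> \<open>Index 1 is split off: with \<open>lam 1 = r\<close> its factor becomes the
    quadratic factor of \<open>?q\<close>. The other factors split by
    \<open>root_plus_minus\<close>.\<close>
  have f: "(\<Prod>j\<in>{1..?p1}. t\<^sup>2 + 2 * t - 4 * of_nat r - (2 * t + 8) * of_real (lam j)) =
      (t\<^sup>2 - 2 * (of_nat r - 1) * t - 12 * of_nat r) * poly ?f t" for t
  proof -
    have "{1..?p1} = insert 1 {2..?p1}" using p1 by auto
    then have "(\<Prod>j\<in>{1..?p1}. t\<^sup>2 + 2 * t - 4 * of_nat r - (2 * t + 8) * of_real (lam j)) =
      (t\<^sup>2 + 2 * t - 4 * of_nat r - (2 * t + 8) * of_real (lam 1)) *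
      (\<Prod>j\<in>{2..?p1}. t\<^sup>2 + 2 * t - 4 * of_nat r - (2 * t + 8) * of_real (lam j))"
      by simp
    also have "(\<Prod>j\<in>{2..?p1}. t\<^sup>2 + 2 * t - 4 * of_nat r - (2 * t + 8) * of_real (lam j)) = poly ?f t"
      unfolding poly_prod
    proof (rule prod.cong[OF refl])
      fix j assume "j \<in> {2..?p1}"
      then have "- real r \<le> lam j" by (intro spec(2)) auto
      then show "t\<^sup>2 + 2 * t - 4 * of_nat r - (2 * t + 8) * of_real (lam j) =
          poly ([:- root_plus (lam j), 1:] * [:- root_minus (lam j), 1:]) t"
        unfolding root_plus_minus[OF \<open>- real r \<le> lam j\<close>, of t, symmetric] poly_mult by simp
    qed
    also have "t\<^sup>2 + 2 * t - 4 * of_nat r - (2 * t + 8) * complex_of_real (lam 1) =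
        t\<^sup>2 - 2 * (of_nat r - 1) * t - 12 * of_nat r"
      unfolding spec(1) by (simp add: algebra_simps)
    finally show ?thesis .
  qed
  have "?chi * ?s ^ ?p1 * ?Q = ([:0, 1:] ^ (?p2 + ?p3 - 2) * ?s ^ card (edges G1) * ?f *
      char_poly quotient_mat) * ?Q"
  proof (rule poly_ext)
    fix t
    let ?X = "det (list_mat (\<lambda>a b. (if a = b then t else 0) - complex_of_real (local_part (parcs G1) a b)) L L)"
    \<comment> \<open>The truncated subtraction is exact because both vertex sets are nonempty; the
      split-off \<open>t\<^sup>2\<close> belongs to \<open>?q\<close>.\<close>
    have "?p2 + ?p3 = (?p2 + ?p3 - 2) + 2" using p1 by simp
    then have pow: "t ^ (?p2 + ?p3) = t ^ (?p2 + ?p3 - 2) * t\<^sup>2" by (metis power_add)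
    have "poly ?chi t * ?q t = ?X * poly (char_poly quotient_mat) t"
      unfolding chi by (rule det_update[OF L])
    then have "poly ?chi t * ?q t * (t + 2) ^ ?p1 =
        ?X * (t + 2) ^ ?p1 * poly (char_poly quotient_mat) t"
      by (simp only: mult_ac)
    also have "?X * (t + 2) ^ ?p1 = t ^ length ws * (t + 2) ^ card (edges G1) *
        (\<Prod>j\<in>{1..?p1}. t\<^sup>2 + 2 * t - 4 * of_nat r - (2 * t + 8) * of_real (lam j))"
      unfolding L_def
      by (rule det_local_part[OF enum es ws(1) char_poly_adjacency[OF lam enum]])
    finally show "poly (?chi * ?s ^ ?p1 * ?Q) t = poly (([:0, 1:] ^ (?p2 + ?p3 - 2) *
        ?s ^ card (edges G1) * ?f * char_poly quotient_mat) * ?Q) t"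
      unfolding f len pow poly_mult[of _ ?Q] Q by (simp add: mult_ac add.commute)
  qed
  \<comment> \<open>The cancellation is done among polynomials, since the values of
    \<open>?Q\<close> vanish at some \<open>t\<close>.\<close>
  moreover have "?Q \<noteq> 0" unfolding mult_eq_0_iff by simp
  ultimately show ?thesis by (rule mult_right_cancel[THEN iffD1, rotated])
qed

lemma eigenvalues_eccentricity_matrix:
  assumes lam: "adjacency_eigenvalues G1 lam" and vs: "enumerates vs J"
  shows "eigenvalues (eccentricity_matrix J vs) + replicate_mset (card (pverts G1)) (-2) =
    replicate_mset (card (pverts G2) + card (pverts G3) - 2) 0 + replicate_mset (card (edges G1)) (-2) +
    ({#root_plus (lam j). j \<in># mset_set {2..card (pverts G1)}#} +
     {#root_minus (lam j). j \<in># mset_set {2..card (pverts G1)}#}) + proots (char_poly quotient_mat)"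
proof -
  let ?chi = "char_poly (map_mat complex_of_real (eccentricity_matrix J vs))"
  \<comment> \<open>\<open>proots\<close> turns a product into a sum when the factors are
    nonzero.\<close>
  have nz: "?chi \<noteq> 0" "char_poly quotient_mat \<noteq> 0"
    by (rule char_poly_nonzero[of _ "length vs"], simp add: eccentricity_matrix_def)
      (simp only: quotient_mat_def char_poly_nonzero[OF list_mat_carrier] not_False_eq_True)
  have lin: "(\<Prod>j\<in>{2..card (pverts G1)}. [:- f j, 1:]) \<noteq> 0" for f :: "nat \<Rightarrow> complex"
    by (subst prod_zero_iff) simp_all
  show ?thesis
    using arg_cong[OF char_poly_eccentricity_matrix[OF lam vs], of proots] nz lin
    unfolding prod.distrib eigenvalues_def
    by (simp add: proots_mult proots_power proots_prod_linear add.assoc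
        del: mult_pCons_left mult_pCons_right)
qed

end

text \<open>The bound \<open>2 \<le> p1\<close> gives \<open>G1\<close> an edge, without which
  \<open>G3\<close> would be cut off from the rest of the join. The second conjunct reads a negative
  multiplicity \<open>q1 - p1\<close> as a removal of copies of -2; this happens when
  \<open>G1\<close> is a single edge.\<close>

theorem theorem3p19:
  fixes G1 :: "'a pair_pre_digraph" and G2 :: "'b pair_pre_digraph" and G3 :: "'c pair_pre_digraph"
    and r1 r2 r3 p1 p2 p3 q1 q2 q3 :: nat
    and lam1 lam2 lam3 :: "nat \<Rightarrow> real"
    and vs :: "(('a + 'a set) + ('b + 'c)) list"
  assumes "pair_graph G1" and "pair_graph G2" and "pair_graph G3"
    and "Digraph_Component.connected (with_proj G1)"
    and "Digraph_Component.connected (with_proj G2)"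
    and "Digraph_Component.connected (with_proj G3)"
    and "regular G1 r1" and "regular G2 r2" and "regular G3 r3"
    and "p1 = card (pverts G1)" and "p2 = card (pverts G2)" and "p3 = card (pverts G3)"
    and "q1 = card (edges G1)" and "q2 = card (edges G2)" and "q3 = card (edges G3)"
    and "adjacency_eigenvalues G1 lam1"
    and "adjacency_eigenvalues G2 lam2"
    and "adjacency_eigenvalues G3 lam3"
    and "triangle_free G1"
    and "2 \<le> p1"
    and "enumerates vs (central_vertex_edge_join G1 G2 G3)"
  shows
    "let E = eigenvalues (eccentricity_matrix (central_vertex_edge_join G1 G2 G3) vs);
         F1 = {# complex_of_real ((-1 + lam1 j) + sqrt ((1 + lam1 j)\<^sup>2 + 4 * (lam1 j + real r1))).
                 j \<in># mset_set {2..p1} #}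
            + {# complex_of_real ((-1 + lam1 j) - sqrt ((1 + lam1 j)\<^sup>2 + 4 * (lam1 j + real r1))).
                 j \<in># mset_set {2..p1} #};
         F3 = replicate_mset (p2 + p3 - 2) 0;
         F4 = eigenvalues (mat_of_rows_list 4
                [[2 * real r1, 2 * (real q1 - real r1), 0, 2 * real p3],
                 [2 * (real p1 - 2), 2 * (real q1 - 1), 2 * real p2, 0],
                 [0, 2 * real q1, 0, 3 * real p3],
                 [2 * real p1, 0, 3 * real p2, 0]])
     in (p1 \<le> q1 \<longrightarrow> E = F1 + replicate_mset (q1 - p1) (-2) + F3 + F4)
      \<and> (q1 < p1 \<longrightarrow> E + replicate_mset (p1 - q1) (-2) = F1 + F3 + F4)"
proof -
  interpret G1: pair_graph G1 by fact
  interpret G2: pair_graph G2 by fact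
  interpret G3: pair_graph G3 by fact
  interpret central_join G1 G2 G3 r1
  proof
    show "regular G1 r1" "triangle_free G1" by fact+
    show "\<exists>v. (u, v) \<in> parcs G1" if "u \<in> pverts G1" for u
      using G1.connected_ex_neighbour[OF assms(4) _ that] assms(10,20) by simp
    show "pverts G1 \<noteq> {}" "pverts G2 \<noteq> {}" "pverts G3 \<noteq> {}"
      using assms(4-6) G1.connected_pverts_nonempty G2.connected_pverts_nonempty
        G3.connected_pverts_nonempty by auto
  qed
  define E where "E = eigenvalues (eccentricity_matrix (central_vertex_edge_join G1 G2 G3) vs)"
  define F1 where "F1 =
    {# complex_of_real ((-1 + lam1 j) + sqrt ((1 + lam1 j)\<^sup>2 + 4 * (lam1 j + real r1))).
       j \<in># mset_set {2..p1} #} +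
    {# complex_of_real ((-1 + lam1 j) - sqrt ((1 + lam1 j)\<^sup>2 + 4 * (lam1 j + real r1))).
       j \<in># mset_set {2..p1} #}"
  define F3 where "F3 = replicate_mset (p2 + p3 - 2) (0 :: complex)"
  define F4 where "F4 = eigenvalues (mat_of_rows_list 4
                [[2 * real r1, 2 * (real q1 - real r1), 0, 2 * real p3],
                 [2 * (real p1 - 2), 2 * (real q1 - 1), 2 * real p2, 0],
                 [0, 2 * real q1, 0, 3 * real p3],
                 [2 * real p1, 0, 3 * real p2, 0]])"
  have F4: "F4 = proots (char_poly quotient_mat)"
    unfolding F4_def eigenvalues_def quotient_mat_eq assms(10-13) ..
  have "enumerates vs J" using assms(21) by (simp add: J_def)
  from eigenvalues_eccentricity_matrix[OF assms(16) this]
  have main: "E + replicate_mset p1 (-2) = F3 + replicate_mset q1 (-2) + F1 + F4"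
    unfolding F4 E_def F3_def F1_def root_plus_def root_minus_def J_def
      assms(10-13) .
  have split: "replicate_mset (m + n) x = replicate_mset m x + replicate_mset n x" for m n and x :: complex
    by (induction m) simp_all
  \<comment> \<open>Under \<open>p1 \<le> q1\<close> the subtraction is exact, and the
    \<open>p1\<close> common copies of -2 cancel from \<open>main\<close>.\<close>
  have "E = F1 + replicate_mset (q1 - p1) (-2) + F3 + F4" if "p1 \<le> q1"
    using main that split[of "q1 - p1" p1 "-2"] by simp
  moreover have "E + replicate_mset (p1 - q1) (-2) = F1 + F3 + F4" if "q1 < p1"
  proof -
    have "replicate_mset p1 (-2 :: complex) = replicate_mset (p1 - q1) (-2) + replicate_mset q1 (-2)"
      using split[of "p1 - q1" q1 "-2"] that by simp
    then have "(E + replicate_mset (p1 - q1) (-2)) + replicate_mset q1 (-2) =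
        (F1 + F3 + F4) + replicate_mset q1 (-2)"
      using main by (simp add: ac_simps)
    then show ?thesis by simp
  qed
  ultimately show ?thesis
    unfolding Let_def E_def[symmetric] F1_def[symmetric] F3_def[symmetric] F4_def[symmetric] by blast
qed

end
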